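(* Let $n$ be a positive integer. For any two distinct partitions $(n_1,\ldots,n_r)$ and $(m_1,\ldots,m_s)$ of $n$, the multiprojective spaces $\mathbb{P}^{n_1}\times\cdots\times\mathbb{P}^{n_r}$ and $\mathbb{P}^{m_1}\times\cdots\times\mathbb{P}^{m_s}$ are non-isomorphic.
   Context: $\mathbb{P}^k$ denotes the complex projective space of dimension $k$, and a multiprojective space is a finite product of such projective spaces. A partition of $n$ is a finite tuple of positive integers with sum $n$, considered up to reordering of its entries; so two partitions are distinct if they differ as multisets of positive integers. Isomorphic means isomorphic as algebraic varieties over $\mathbb{C}$. *)

theory Defs
  imports "HOL-Analysis.Analysis" "HOL-Library.Poly_Mapping"
begin

definition partition_of :: "nat list \<Rightarrow> nat \<Rightarrow> bool" where
  "partition_of ns n \<longleftrightarrow> 0 \<notin> set ns \<and> sum_list ns = n"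


section \<open>Varieties as spaces with functions\<close>

text \<open>
  A classical complex variety is given by its Zariski topology together with its sheaf of
  regular functions, which are \<open>\<complex>\<close>-valued functions on open sets. A function on an open set
  \<open>U\<close> is represented by a total function whose values off \<open>U\<close> are irrelevant.
\<close>

record 'a variety =
  zariski :: "'a topology"
  regular :: "'a set \<Rightarrow> ('a \<Rightarrow> complex) set"

definition variety_morphism :: "'a variety \<Rightarrow> 'b variety \<Rightarrow> ('a \<Rightarrow> 'b) \<Rightarrow> bool" where
  "variety_morphism X Y \<phi> \<longleftrightarrow>
     continuous_map (zariski X) (zariski Y) \<phi> \<and>
     (\<forall>V f. openin (zariski Y) V \<and> f \<in> regular Y V \<longrightarrow>
        f \<circ> \<phi> \<in> regular X {x \<in> topspace (zariski X). \<phi> x \<in> V})"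

definition isomorphic_varieties :: "'a variety \<Rightarrow> 'b variety \<Rightarrow> bool" where
  "isomorphic_varieties X Y \<longleftrightarrow>
     (\<exists>\<phi> \<psi>. variety_morphism X Y \<phi> \<and> variety_morphism Y X \<psi> \<and>
        (\<forall>x \<in> topspace (zariski X). \<psi> (\<phi> x) = x) \<and>
        (\<forall>y \<in> topspace (zariski Y). \<phi> (\<psi> y) = y))"


section \<open>Projective space and products of projective spaces\<close>

text \<open>\<open>\<complex>\<^sup>k\<^sup>+\<^sup>1\<close>, with coordinates indexed by \<open>0, \<dots>, k\<close>, minus the origin.\<close>

definition punctured_space :: "nat \<Rightarrow> (nat \<Rightarrow> complex) set" where
  "punctured_space k = {v. (\<forall>j>k. v j = 0) \<and> (\<exists>j. v j \<noteq> 0)}"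

definition proportional :: "nat \<Rightarrow> ((nat \<Rightarrow> complex) \<times> (nat \<Rightarrow> complex)) set" where
  "proportional k = {(v, w). v \<in> punctured_space k \<and> w \<in> punctured_space k \<and>
     (\<exists>c. c \<noteq> 0 \<and> w = (\<lambda>j. c * v j))}"

definition projective_space :: "nat \<Rightarrow> (nat \<Rightarrow> complex) set set" where
  "projective_space k = punctured_space k // proportional k"

definition multiproj_points :: "nat list \<Rightarrow> (nat \<Rightarrow> (nat \<Rightarrow> complex) set) set" where
  "multiproj_points ns = (\<Pi>\<^sub>E i\<in>{..<length ns}. projective_space (ns ! i))"

text \<open>The tuples of homogeneous coordinate vectors of a point.\<close>

definition multiproj_coords ::
    "nat list \<Rightarrow> (nat \<Rightarrow> (nat \<Rightarrow> complex) set) \<Rightarrow> (nat \<Rightarrow> nat \<Rightarrow> complex) set" where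
  "multiproj_coords ns P = (\<Pi> i\<in>{..<length ns}. P i)"

text \<open>
  Polynomials in variables indexed by \<open>'v\<close>: finitely supported maps from exponent vectors
  to coefficients. The variable \<open>(i, j)\<close> below is the \<open>j\<close>-th homogeneous coordinate of the
  \<open>i\<close>-th factor.
\<close>

definition mpoly_eval :: "('v \<Rightarrow> complex) \<Rightarrow> (('v \<Rightarrow>\<^sub>0 nat) \<Rightarrow>\<^sub>0 complex) \<Rightarrow> complex" where
  "mpoly_eval x F = (\<Sum>m\<in>Poly_Mapping.keys F.
     Poly_Mapping.lookup F m *
       (\<Prod>v\<in>Poly_Mapping.keys m. x v ^ Poly_Mapping.lookup m v))"

definition multihomogeneous ::
    "nat list \<Rightarrow> (nat \<Rightarrow> nat) \<Rightarrow> ((nat \<times> nat \<Rightarrow>\<^sub>0 nat) \<Rightarrow>\<^sub>0 complex) set" where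
  "multihomogeneous ns d = {F. \<forall>m\<in>Poly_Mapping.keys F.
     Poly_Mapping.keys m \<subseteq> (SIGMA i:{..<length ns}. {..ns ! i}) \<and>
     (\<forall>i<length ns. (\<Sum>j\<le>ns ! i. Poly_Mapping.lookup m (i, j)) = d i)}"

text \<open>
  Whether a multihomogeneous polynomial vanishes at a coordinate tuple, and the quotient of
  two such polynomials of equal multidegree, do not depend on the coordinates chosen for
  the point. Hence the quantifiers over all coordinate tuples below.
\<close>

definition multiproj_zeros ::
    "nat list \<Rightarrow> ((nat \<times> nat \<Rightarrow>\<^sub>0 nat) \<Rightarrow>\<^sub>0 complex) set \<Rightarrow> (nat \<Rightarrow> (nat \<Rightarrow> complex) set) set" where
  "multiproj_zeros ns S = {P \<in> multiproj_points ns.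
     \<forall>F\<in>S. \<forall>x\<in>multiproj_coords ns P. mpoly_eval (case_prod x) F = 0}"

definition multiproj_open :: "nat list \<Rightarrow> (nat \<Rightarrow> (nat \<Rightarrow> complex) set) set \<Rightarrow> bool" where
  "multiproj_open ns U \<longleftrightarrow> U \<subseteq> multiproj_points ns \<and>
     (\<exists>S. S \<subseteq> (\<Union>d. multihomogeneous ns d) \<and> multiproj_points ns - U = multiproj_zeros ns S)"

definition multiproj_regular ::
    "nat list \<Rightarrow> (nat \<Rightarrow> (nat \<Rightarrow> complex) set) set
       \<Rightarrow> ((nat \<Rightarrow> (nat \<Rightarrow> complex) set) \<Rightarrow> complex) set" where
  "multiproj_regular ns U = {f. \<forall>P\<in>U. \<exists>V. multiproj_open ns V \<and> P \<in> V \<and> V \<subseteq> U \<and>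
     (\<exists>d. \<exists>F\<in>multihomogeneous ns d. \<exists>G\<in>multihomogeneous ns d.
        \<forall>Q\<in>V. \<forall>x\<in>multiproj_coords ns Q.
          mpoly_eval (case_prod x) G \<noteq> 0 \<and>
          f Q = mpoly_eval (case_prod x) F / mpoly_eval (case_prod x) G)}"

definition multiprojective_space :: "nat list \<Rightarrow> (nat \<Rightarrow> (nat \<Rightarrow> complex) set) variety" where
  "multiprojective_space ns =
     \<lparr>zariski = topology (multiproj_open ns), regular = multiproj_regular ns\<rparr>"


section \<open>The Zariski topology is a topology\<close>

lemma mpoly_eval_superset:
  assumes "finite A" "Poly_Mapping.keys F \<subseteq> A"
  shows "mpoly_eval x F = (\<Sum>m\<in>A. Poly_Mapping.lookup F m *
       (\<Prod>v\<in>Poly_Mapping.keys m. x v ^ Poly_Mapping.lookup m v))"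
  unfolding mpoly_eval_def using assms
  by (intro sum.mono_neutral_left) (auto simp: in_keys_iff)

lemma mpoly_eval_zero [simp]: "mpoly_eval x 0 = 0"
  by (simp add: mpoly_eval_def)

lemma mpoly_eval_one [simp]: "mpoly_eval x 1 = 1"
  by (simp add: mpoly_eval_def)

lemma mpoly_eval_add: "mpoly_eval x (F + G) = mpoly_eval x F + mpoly_eval x G"
proof -
  let ?A = "Poly_Mapping.keys F \<union> Poly_Mapping.keys G"
  have "finite ?A" "Poly_Mapping.keys (F + G) \<subseteq> ?A"
    using keys_add[of F G] by auto
  then show ?thesis
    by (simp add: mpoly_eval_superset[of ?A] lookup_add distrib_right sum.distrib)
qed

lemma mpoly_eval_sum: "mpoly_eval x (sum f A) = (\<Sum>a\<in>A. mpoly_eval x (f a))"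
  by (induction A rule: infinite_finite_induct) (auto simp: mpoly_eval_add)

lemma monomial_superset:
  fixes x :: "'v \<Rightarrow> complex"
  assumes "finite A" "Poly_Mapping.keys m \<subseteq> A"
  shows "(\<Prod>v\<in>Poly_Mapping.keys m. x v ^ Poly_Mapping.lookup m v) =
    (\<Prod>v\<in>A. x v ^ Poly_Mapping.lookup m v)"
  using assms by (intro prod.mono_neutral_left) (auto simp: in_keys_iff)

lemma monomial_add:
  fixes x :: "'v \<Rightarrow> complex"
  shows "(\<Prod>v\<in>Poly_Mapping.keys (m + m'). x v ^ Poly_Mapping.lookup (m + m') v) =
    (\<Prod>v\<in>Poly_Mapping.keys m. x v ^ Poly_Mapping.lookup m v) *
    (\<Prod>v\<in>Poly_Mapping.keys m'. x v ^ Poly_Mapping.lookup m' v)"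
proof -
  let ?A = "Poly_Mapping.keys m \<union> Poly_Mapping.keys m'"
  have "finite ?A" "Poly_Mapping.keys (m + m') \<subseteq> ?A"
    using keys_add[of m m'] by auto
  then show ?thesis
    using monomial_superset[of ?A "m + m'" x] monomial_superset[of ?A m x]
      monomial_superset[of ?A m' x]
    by (simp only: lookup_add power_add prod.distrib) simp
qed

lemma mpoly_eval_single:
  "mpoly_eval x (Poly_Mapping.single m c) =
    c * (\<Prod>v\<in>Poly_Mapping.keys m. x v ^ Poly_Mapping.lookup m v)"
  by (simp add: mpoly_eval_def)

lemma mpoly_expansion:
  fixes F :: "('v \<Rightarrow>\<^sub>0 nat) \<Rightarrow>\<^sub>0 complex"
  shows "F = (\<Sum>m\<in>Poly_Mapping.keys F. Poly_Mapping.single m (Poly_Mapping.lookup F m))"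
  by (rule poly_mapping_eqI) (auto simp: lookup_sum lookup_single when_def in_keys_iff)

lemma mpoly_eval_mult: "mpoly_eval x (F * G) = mpoly_eval x F * mpoly_eval x G"
proof -
  have "mpoly_eval x (F * G) = mpoly_eval x
      ((\<Sum>m\<in>Poly_Mapping.keys F. Poly_Mapping.single m (Poly_Mapping.lookup F m)) *
       (\<Sum>m\<in>Poly_Mapping.keys G. Poly_Mapping.single m (Poly_Mapping.lookup G m)))"
    by (simp only: mpoly_expansion[symmetric])
  also have "\<dots> = mpoly_eval x F * mpoly_eval x G"
    by (simp add: sum_product mult_single mpoly_eval_sum mpoly_eval_single monomial_add)
      (simp add: mpoly_eval_def sum_product mult_ac)
  finally show ?thesis .
qed

lemma multihomogeneous_mult:
  assumes "F \<in> multihomogeneous ns d" "G \<in> multihomogeneous ns e"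
  shows "F * G \<in> multihomogeneous ns (\<lambda>i. d i + e i)"
proof -
  have "Poly_Mapping.keys m \<subseteq> (SIGMA i:{..<length ns}. {..ns ! i}) \<and>
     (\<forall>i<length ns. (\<Sum>j\<le>ns ! i. Poly_Mapping.lookup m (i, j)) = d i + e i)"
    if mFG: "m \<in> Poly_Mapping.keys (F * G)" for m
  proof -
    obtain a b where m: "m = a + b" "a \<in> Poly_Mapping.keys F" "b \<in> Poly_Mapping.keys G"
      using mFG keys_mult[of F G] by blast
    have a: "Poly_Mapping.keys a \<subseteq> (SIGMA i:{..<length ns}. {..ns ! i})"
      "\<And>i. i < length ns \<Longrightarrow> (\<Sum>j\<le>ns ! i. Poly_Mapping.lookup a (i, j)) = d i"
      using assms(1) m(2) unfolding multihomogeneous_def by blast+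
    have b: "Poly_Mapping.keys b \<subseteq> (SIGMA i:{..<length ns}. {..ns ! i})"
      "\<And>i. i < length ns \<Longrightarrow> (\<Sum>j\<le>ns ! i. Poly_Mapping.lookup b (i, j)) = e i"
      using assms(2) m(3) unfolding multihomogeneous_def by blast+
    have "Poly_Mapping.keys m \<subseteq> (SIGMA i:{..<length ns}. {..ns ! i})"
      unfolding m(1) by (rule order_trans[OF keys_add Un_least[OF a(1) b(1)]])
    then show ?thesis
      by (simp add: m(1) lookup_add sum.distrib a(2) b(2))
  qed
  then show ?thesis
    by (simp add: multihomogeneous_def)
qed

lemma one_multihomogeneous: "1 \<in> multihomogeneous ns (\<lambda>_. 0)"
  by (simp add: multihomogeneous_def)

lemma mpoly_eval_scale:
  assumes F: "F \<in> multihomogeneous ns d"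
    and y: "\<And>i j. i < length ns \<Longrightarrow> y i j = c i * x i j"
  shows "mpoly_eval (case_prod y) F = (\<Prod>i<length ns. c i ^ d i) * mpoly_eval (case_prod x) F"
proof -
  let ?V = "SIGMA i:{..<length ns}. {..ns ! i}"
  have "(\<Prod>v\<in>Poly_Mapping.keys m. case_prod y v ^ Poly_Mapping.lookup m v) =
     (\<Prod>i<length ns. c i ^ d i) *
     (\<Prod>v\<in>Poly_Mapping.keys m. case_prod x v ^ Poly_Mapping.lookup m v)"
    if "m \<in> Poly_Mapping.keys F" for m
  proof -
    have m: "Poly_Mapping.keys m \<subseteq> ?V"
      "\<And>i. i < length ns \<Longrightarrow> (\<Sum>j\<le>ns ! i. Poly_Mapping.lookup m (i, j)) = d i"
      using F that unfolding multihomogeneous_def by blast+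
    have "(\<Prod>v\<in>?V. case_prod y v ^ Poly_Mapping.lookup m v) =
      (\<Prod>v\<in>?V. c (fst v) ^ Poly_Mapping.lookup m v * case_prod x v ^ Poly_Mapping.lookup m v)"
      by (rule prod.cong) (auto simp: y power_mult_distrib)
    also have "\<dots> = (\<Prod>v\<in>?V. c (fst v) ^ Poly_Mapping.lookup m v) *
      (\<Prod>v\<in>?V. case_prod x v ^ Poly_Mapping.lookup m v)"
      by (rule prod.distrib)
    also have "(\<Prod>v\<in>?V. c (fst v) ^ Poly_Mapping.lookup m v) =
      (\<Prod>i<length ns. \<Prod>j\<le>ns ! i. c i ^ Poly_Mapping.lookup m (i, j))"
      by (subst prod.Sigma) (auto intro!: prod.cong)
    also have "\<dots> = (\<Prod>i<length ns. c i ^ d i)"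
      by (rule prod.cong) (auto simp: m(2) simp flip: power_sum)
    finally show ?thesis
      using m(1) by (simp add: monomial_superset[of ?V])
  qed
  then show ?thesis
    unfolding mpoly_eval_def by (simp add: sum_distrib_left mult_ac)
qed

lemma projective_space_proportional:
  assumes "p \<in> projective_space k" "v \<in> p" "w \<in> p"
  shows "\<exists>c. c \<noteq> 0 \<and> w = (\<lambda>j. c * v j)"
proof -
  obtain u where u: "p = proportional k `` {u}"
    using assms(1) unfolding projective_space_def quotient_def by blast
  obtain a b where a: "a \<noteq> 0" "v = (\<lambda>j. a * u j)" and b: "b \<noteq> 0" "w = (\<lambda>j. b * u j)"
    using assms(2,3) unfolding u proportional_def by blast
  then show ?thesis
    by (intro exI[of _ "b / a"]) auto
qed

lemma projective_space_nonempty: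
  assumes "p \<in> projective_space k"
  shows "p \<noteq> {}"
proof -
  obtain u where u: "u \<in> punctured_space k" "p = proportional k `` {u}"
    using assms unfolding projective_space_def quotient_def by blast
  have "(u, u) \<in> proportional k"
    using u(1) by (auto simp: proportional_def intro: exI[of _ 1])
  then show ?thesis
    using u(2) by blast
qed

lemma multiproj_coords_nonempty:
  assumes "P \<in> multiproj_points ns"
  shows "multiproj_coords ns P \<noteq> {}"
proof -
  have "P i \<noteq> {}" if "i < length ns" for i
    using assms that projective_space_nonempty[of "P i" "ns ! i"]
    by (auto simp: multiproj_points_def PiE_iff)
  then show ?thesis
    unfolding multiproj_coords_def by (subst Pi_eq_empty) simp
qed

lemma multiproj_vanish_indep:
  assumes P: "P \<in> multiproj_points ns" and F: "F \<in> multihomogeneous ns d"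
    and x: "x \<in> multiproj_coords ns P" and y: "y \<in> multiproj_coords ns P"
    and 0: "mpoly_eval (case_prod x) F = 0"
  shows "mpoly_eval (case_prod y) F = 0"
proof -
  have "\<exists>c. y i = (\<lambda>j. c * x i j)" if "i < length ns" for i
    using projective_space_proportional[of "P i" "ns ! i" "x i" "y i"] P x y that
    by (auto simp: multiproj_points_def multiproj_coords_def PiE_iff Pi_iff)
  then obtain c where "\<And>i. i < length ns \<Longrightarrow> y i = (\<lambda>j. c i * x i j)"
    by metis
  then show ?thesis
    using mpoly_eval_scale[OF F, of y c x] 0 by simp
qed

lemma multiproj_zeros_Un:
  assumes S: "S \<subseteq> (\<Union>d. multihomogeneous ns d)" and T: "T \<subseteq> (\<Union>d. multihomogeneous ns d)"
  shows "multiproj_zeros ns S \<union> multiproj_zeros ns T =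
    multiproj_zeros ns {F * G | F G. F \<in> S \<and> G \<in> T}"
proof
  show "multiproj_zeros ns S \<union> multiproj_zeros ns T \<subseteq>
    multiproj_zeros ns {F * G | F G. F \<in> S \<and> G \<in> T}"
    by (auto simp: multiproj_zeros_def mpoly_eval_mult)
  show "multiproj_zeros ns {F * G | F G. F \<in> S \<and> G \<in> T} \<subseteq>
    multiproj_zeros ns S \<union> multiproj_zeros ns T"
  proof (rule ccontr)
    assume "\<not> ?thesis"
    then obtain P where P: "P \<in> multiproj_points ns"
      "P \<in> multiproj_zeros ns {F * G | F G. F \<in> S \<and> G \<in> T}"
      "P \<notin> multiproj_zeros ns S" "P \<notin> multiproj_zeros ns T"
      by (auto simp: multiproj_zeros_def)
    obtain F x where F: "F \<in> S" "x \<in> multiproj_coords ns P" "mpoly_eval (case_prod x) F \<noteq> 0"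
      using P(1,3) unfolding multiproj_zeros_def by blast
    obtain G y where G: "G \<in> T" "y \<in> multiproj_coords ns P" "mpoly_eval (case_prod y) G \<noteq> 0"
      using P(1,4) unfolding multiproj_zeros_def by blast
    obtain d where "G \<in> multihomogeneous ns d"
      using G(1) T by blast
    then have "mpoly_eval (case_prod x) G \<noteq> 0"
      using multiproj_vanish_indep[OF P(1) _ F(2) G(2)] G(3) by blast
    moreover have "mpoly_eval (case_prod x) (F * G) = 0"
      using P(2) F(1,2) G(1) unfolding multiproj_zeros_def by blast
    ultimately show False
      using F(3) by (simp add: mpoly_eval_mult)
  qed
qed

lemma istopology_multiproj_open: "istopology (multiproj_open ns)"
  unfolding istopology_def
proof (intro conjI allI impI)
  fix U V assume U: "multiproj_open ns U" and V: "multiproj_open ns V"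
  obtain S where S: "S \<subseteq> (\<Union>d. multihomogeneous ns d)"
    "multiproj_points ns - U = multiproj_zeros ns S"
    using U unfolding multiproj_open_def by blast
  obtain T where T: "T \<subseteq> (\<Union>d. multihomogeneous ns d)"
    "multiproj_points ns - V = multiproj_zeros ns T"
    using V unfolding multiproj_open_def by blast
  let ?R = "{F * G | F G. F \<in> S \<and> G \<in> T}"
  have "?R \<subseteq> (\<Union>d. multihomogeneous ns d)"
  proof
    fix H assume "H \<in> ?R"
    then obtain F G where H: "H = F * G" "F \<in> S" "G \<in> T"
      by blast
    obtain d e where "F \<in> multihomogeneous ns d" "G \<in> multihomogeneous ns e"
      using H(2,3) S(1) T(1) by blast
    then have "H \<in> multihomogeneous ns (\<lambda>i. d i + e i)"
      unfolding H(1) by (rule multihomogeneous_mult)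
    then show "H \<in> (\<Union>d. multihomogeneous ns d)"
      by blast
  qed
  moreover have "multiproj_points ns - U \<inter> V = multiproj_zeros ns ?R"
    by (simp only: multiproj_zeros_Un[OF S(1) T(1), symmetric] S(2)[symmetric] T(2)[symmetric]
      Diff_Int)
  moreover have "U \<inter> V \<subseteq> multiproj_points ns"
    using U unfolding multiproj_open_def by blast
  ultimately show "multiproj_open ns (U \<inter> V)"
    unfolding multiproj_open_def by (intro conjI exI[of _ ?R]) assumption+
next
  fix K assume K: "\<forall>U\<in>K. multiproj_open ns U"
  then obtain S where S: "\<And>U. U \<in> K \<Longrightarrow> S U \<subseteq> (\<Union>d. multihomogeneous ns d)"
    "\<And>U. U \<in> K \<Longrightarrow> multiproj_points ns - U = multiproj_zeros ns (S U)"
    unfolding multiproj_open_def by metis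
  have "multiproj_points ns - \<Union>K = multiproj_zeros ns (\<Union>U\<in>K. S U)"
  proof -
    have "multiproj_zeros ns (\<Union>U\<in>K. S U) =
      {P \<in> multiproj_points ns. \<forall>U\<in>K. P \<in> multiproj_zeros ns (S U)}"
      by (auto simp: multiproj_zeros_def)
    also have "\<dots> = {P \<in> multiproj_points ns. \<forall>U\<in>K. P \<in> multiproj_points ns - U}"
      using S(2) by auto
    finally show ?thesis
      by auto
  qed
  moreover have "(\<Union>U\<in>K. S U) \<subseteq> (\<Union>d. multihomogeneous ns d)"
    using S(1) by blast
  moreover have "\<Union>K \<subseteq> multiproj_points ns"
    using K by (auto simp: multiproj_open_def)
  ultimately show "multiproj_open ns (\<Union>K)"
    unfolding multiproj_open_def by (intro conjI exI[of _ "\<Union>U\<in>K. S U"]) assumption+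
qed

lemma openin_multiprojective_space [simp]:
  "openin (zariski (multiprojective_space ns)) = multiproj_open ns"
  by (simp add: multiprojective_space_def topology_inverse' istopology_multiproj_open)

lemma multiproj_open_points: "multiproj_open ns (multiproj_points ns)"
proof -
  have "multiproj_points ns - multiproj_points ns = multiproj_zeros ns {1}"
    using multiproj_coords_nonempty by (auto simp: multiproj_zeros_def)
  moreover have "{1} \<subseteq> (\<Union>d. multihomogeneous ns d)"
    using one_multihomogeneous by blast
  ultimately show ?thesis
    unfolding multiproj_open_def by blast
qed

lemma topspace_multiprojective_space [simp]:
  "topspace (zariski (multiprojective_space ns)) = multiproj_points ns"
proof
  show "topspace (zariski (multiprojective_space ns)) \<subseteq> multiproj_points ns"
    unfolding topspace_def by (auto simp: multiproj_open_def)
  show "multiproj_points ns \<subseteq> topspace (zariski (multiprojective_space ns))"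
    by (rule openin_subset) (simp add: multiproj_open_points)
qed

end

(*
  Let phi be an isomorphism between the two products, with inverse psi. A morphism to projective
  space that contracts one curve of a continuous family of images of P^1 contracts all of them
  (near a contracted curve it lands in an affine chart, where Liouville's theorem applies). Moving
  a curve by transvections of factor i shows: if a component phi_j contracts a curve whose
  projection to factor i is not constant, then phi_j does not depend on factor i at all.
  Applied to the images under psi of lines in a factor k other than j, this says that psi_i does
  not depend on factor k as soon as phi_j depends on factor i. Hence the dependence relations of
  phi and psi are mutually inverse bijections between the factors, and phi is a product of
  isomorphisms of single projective spaces. These preserve the dimension, because inverse
  Jacobians A and B satisfy tr (A B) = tr (B A).
*)
theory Submission
  imports Defs "HOL-Complex_Analysis.Complex_Analysis"
begin

section \<open>Points and homogeneous coordinates\<close>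

text \<open>The statement is algebraic, but rigidity is proved in the classical topology: the
  deformation parameter is real, so that an open and closed set of parameters is everything, and
  compactness of the projective line puts a whole nearby curve into one chart. All that has to be
  known of a curve is that it has local holomorphic lifts to homogeneous coordinates, a notion that
  survives composition with a morphism. Transvections serve because a single one fixes one point of
  the curve, moves another, and is joined to the identity by the parameter. The fixed point anchors
  the value of the component. Only the slice through one point is reached in this way; a second
  deformation, which slides the other factors, carries the result to all points. Positivity of the
  parts makes every component of phi and psi nonconstant, so each component depends on some factor.
  Comparing Jacobians by traces needs just the existence of derivatives, at one point and in one
  pair of charts.\<close>

definition valid_coords :: "nat list \<Rightarrow> (nat \<Rightarrow> nat \<Rightarrow> complex) \<Rightarrow> bool" where
  "valid_coords ns x \<longleftrightarrow> (\<forall>i<length ns. x i \<in> punctured_space (ns ! i))"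

definition proj_class :: "nat \<Rightarrow> (nat \<Rightarrow> complex) \<Rightarrow> (nat \<Rightarrow> complex) set" where
  "proj_class k v = proportional k `` {v}"

definition point_of :: "nat list \<Rightarrow> (nat \<Rightarrow> nat \<Rightarrow> complex) \<Rightarrow> nat \<Rightarrow> (nat \<Rightarrow> complex) set" where
  "point_of ns x = (\<lambda>i\<in>{..<length ns}. proj_class (ns ! i) (x i))"

lemma mem_proj_class:
  "v \<in> punctured_space k \<Longrightarrow> w \<in> proj_class k v \<longleftrightarrow> (\<exists>c. c \<noteq> 0 \<and> w = (\<lambda>j. c * v j))"
  by (auto simp: proj_class_def proportional_def punctured_space_def)

lemma self_mem_proj_class: "v \<in> punctured_space k \<Longrightarrow> v \<in> proj_class k v"
  by (auto simp: mem_proj_class intro!: exI[of _ 1])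

lemma proj_class_mem_punctured: "w \<in> proj_class k v \<Longrightarrow> w \<in> punctured_space k"
  by (auto simp: proj_class_def proportional_def)

lemma proj_class_in_projective_space:
  "v \<in> punctured_space k \<Longrightarrow> proj_class k v \<in> projective_space k"
  by (auto simp: proj_class_def projective_space_def quotient_def)

lemma proj_class_scale:
  assumes "c \<noteq> 0"
  shows "proj_class k (\<lambda>j. c * v j) = proj_class k v"
proof -
  have p: "(\<lambda>j. c * v j) \<in> punctured_space k \<longleftrightarrow> v \<in> punctured_space k"
    using assms by (auto simp: punctured_space_def)
  have "(\<exists>a. a \<noteq> 0 \<and> w = (\<lambda>j. a * (c * v j))) \<longleftrightarrow> (\<exists>a. a \<noteq> 0 \<and> w = (\<lambda>j. a * v j))" for w
  proof
    assume "\<exists>a. a \<noteq> 0 \<and> w = (\<lambda>j. a * (c * v j))"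
    then obtain a where "a \<noteq> 0" "w = (\<lambda>j. a * (c * v j))" by blast
    then show "\<exists>a. a \<noteq> 0 \<and> w = (\<lambda>j. a * v j)"
      using assms by (intro exI[of _ "a * c"]) (auto simp: mult.assoc)
  next
    assume "\<exists>a. a \<noteq> 0 \<and> w = (\<lambda>j. a * v j)"
    then obtain a where "a \<noteq> 0" "w = (\<lambda>j. a * v j)" by blast
    then show "\<exists>a. a \<noteq> 0 \<and> w = (\<lambda>j. a * (c * v j))"
      using assms by (intro exI[of _ "a / c"]) auto
  qed
  then show ?thesis
    unfolding proj_class_def proportional_def using p by auto
qed

lemma proj_class_eq_of_mem:
  assumes "w \<in> proj_class k v"
  shows "proj_class k w = proj_class k v"
proof -
  have "v \<in> punctured_space k"
    using assms by (auto simp: proj_class_def proportional_def)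
  then obtain c where "c \<noteq> 0" "w = (\<lambda>j. c * v j)"
    using assms mem_proj_class by blast
  then show ?thesis by (simp add: proj_class_scale)
qed

lemma projective_space_eq_proj_class:
  assumes "p \<in> projective_space k" "v \<in> p"
  shows "v \<in> punctured_space k" "p = proj_class k v"
proof -
  obtain u where u: "u \<in> punctured_space k" "p = proj_class k u"
    using assms(1) unfolding projective_space_def quotient_def proj_class_def by blast
  show "v \<in> punctured_space k"
    using assms(2) u proj_class_mem_punctured by blast
  show "p = proj_class k v"
    using assms(2) u proj_class_eq_of_mem by blast
qed

text \<open>Vanishing of the 2 x 2 minors is a polynomial condition. In this form equality of points
  becomes a closed condition on families.\<close>

lemma proj_class_eq_iff_minors:
  assumes v: "v \<in> punctured_space k" and w: "w \<in> punctured_space k"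
  shows "proj_class k v = proj_class k w \<longleftrightarrow> (\<forall>a\<le>k. \<forall>b\<le>k. v a * w b = v b * w a)"
proof
  assume "proj_class k v = proj_class k w"
  then have "w \<in> proj_class k v"
    using self_mem_proj_class[OF w] by simp
  then show "\<forall>a\<le>k. \<forall>b\<le>k. v a * w b = v b * w a"
    using mem_proj_class[OF v] by (auto simp: mult_ac)
next
  assume m: "\<forall>a\<le>k. \<forall>b\<le>k. v a * w b = v b * w a"
  obtain b where b: "b \<le> k" "w b \<noteq> 0"
    using w unfolding punctured_space_def by (force simp: not_le[symmetric])
  have eq: "v a = v b / w b * w a" for a
  proof (cases "a \<le> k")
    case True
    then show ?thesis using m b by (simp add: field_simps)
  next
    case False
    then show ?thesis using v w by (simp add: punctured_space_def)
  qed
  have "v b \<noteq> 0"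
  proof
    assume "v b = 0"
    then have "v a = 0" for a using eq[of a] by simp
    then show False using v by (auto simp: punctured_space_def)
  qed
  then have "v b / w b \<noteq> 0" using b by simp
  moreover have "v = (\<lambda>a. v b / w b * w a)" using eq by blast
  ultimately show "proj_class k v = proj_class k w"
    using proj_class_scale by metis
qed

text \<open>If the combination were zero, both \<open>a\<close> and \<open>b\<close> would
  annihilate every 2 x 2 minor of \<open>v\<close> and \<open>w\<close>, making the two points
  equal. Thus \<open>(a, b)\<close> can serve as homogeneous parameter on the line joining two
  distinct points.\<close>

lemma punctured_combination:
  assumes v: "v \<in> punctured_space k" and w: "w \<in> punctured_space k"
    and ne: "proj_class k v \<noteq> proj_class k w" and ab: "a \<noteq> 0 \<or> b \<noteq> 0"
  shows "(\<lambda>j. a * v j + b * w j) \<in> punctured_space k"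
proof (rule ccontr)
  assume "\<not> ?thesis"
  then have z: "a * v j + b * w j = 0" for j
    using v w by (auto simp: punctured_space_def)
  have "v c * w d = v d * w c" for c d
  proof -
    have "a * (v c * w d) = a * (v d * w c)"
    proof -
      have "a * (v c * w d) = (a * v c + b * w c) * w d - b * w c * w d"
        by (simp add: algebra_simps)
      also have "\<dots> = (a * v d + b * w d) * w c - b * w c * w d" by (simp add: z)
      finally show ?thesis by (simp add: algebra_simps)
    qed
    moreover have "b * (v c * w d) = b * (v d * w c)"
    proof -
      have "b * (v c * w d) = (a * v d + b * w d) * v c - a * v c * v d"
        by (simp add: algebra_simps)
      also have "\<dots> = (a * v c + b * w c) * v d - a * v c * v d" by (simp add: z)
      finally show ?thesis by (simp add: algebra_simps)
    qed
    ultimately show ?thesis using ab by auto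
  qed
  then show False
    using ne proj_class_eq_iff_minors[OF v w] by blast
qed

lemma point_of_apply: "i < length ns \<Longrightarrow> point_of ns x i = proj_class (ns ! i) (x i)"
  by (simp add: point_of_def)

lemma point_of_in_points: "valid_coords ns x \<Longrightarrow> point_of ns x \<in> multiproj_points ns"
  by (auto simp: point_of_def multiproj_points_def valid_coords_def proj_class_in_projective_space)

lemma valid_in_coords: "valid_coords ns x \<Longrightarrow> x \<in> multiproj_coords ns (point_of ns x)"
  by (auto simp: point_of_def multiproj_coords_def valid_coords_def self_mem_proj_class)

lemma coords_valid:
  assumes "P \<in> multiproj_points ns" "x \<in> multiproj_coords ns P"
  shows "valid_coords ns x" "P = point_of ns x"
proof -
  have P: "P i \<in> projective_space (ns ! i)" "x i \<in> P i" if "i < length ns" for i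
    using assms that by (auto simp: multiproj_points_def multiproj_coords_def PiE_iff Pi_iff)
  show "valid_coords ns x"
    unfolding valid_coords_def using P projective_space_eq_proj_class(1) by blast
  show "P = point_of ns x"
  proof (rule extensionalityI[of _ "{..<length ns}"])
    show "P \<in> extensional {..<length ns}"
      using assms(1) by (auto simp: multiproj_points_def PiE_iff)
    show "point_of ns x \<in> extensional {..<length ns}"
      by (simp add: point_of_def)
    fix i assume "i \<in> {..<length ns}"
    then show "P i = point_of ns x i"
      using P[of i] projective_space_eq_proj_class(2)[of "P i"] by (simp add: point_of_apply)
  qed
qed

lemma point_obtain_coords:
  assumes "P \<in> multiproj_points ns"
  obtains x where "valid_coords ns x" "P = point_of ns x"
  using multiproj_coords_nonempty[OF assms] coords_valid[OF assms] by blast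

lemma point_of_update:
  "i < length ns \<Longrightarrow> (point_of ns x)(i := proj_class (ns ! i) w) = point_of ns (x(i := w))"
  by (rule ext) (simp add: point_of_def)

lemma valid_coords_update:
  "valid_coords ns x \<Longrightarrow> w \<in> punctured_space (ns ! i) \<Longrightarrow> valid_coords ns (x(i := w))"
  by (auto simp: valid_coords_def)

lemma point_update_in_points:
  assumes "P \<in> multiproj_points ns" "i < length ns" "p \<in> projective_space (ns ! i)"
  shows "P(i := p) \<in> multiproj_points ns"
  using assms by (auto simp: multiproj_points_def PiE_iff extensional_def)

lemma projective_space_obtain:
  assumes "p \<in> projective_space k"
  obtains v where "v \<in> punctured_space k" "p = proj_class k v"
  using projective_space_nonempty[OF assms] projective_space_eq_proj_class[OF assms] by blast

lemma point_of_cong: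
  "(\<And>i. i < length ns \<Longrightarrow> proj_class (ns ! i) (x i) = proj_class (ns ! i) (y i))
    \<Longrightarrow> point_of ns x = point_of ns y"
  unfolding point_of_def by (rule restrict_ext) simp

section \<open>Morphisms in coordinates\<close>

text \<open>Distinguished open sets form a basis: some equation of the complement fails at the
  point, and by homogeneity it fails for the given representative. A single nonvanishing condition
  is also open in the classical topology, which is how Zariski neighbourhoods are used
  later.\<close>

lemma multiproj_open_basic:
  assumes "multiproj_open ns V" "valid_coords ns x0" "point_of ns x0 \<in> V"
  obtains H where "mpoly_eval (case_prod x0) H \<noteq> 0"
    "\<And>x. valid_coords ns x \<Longrightarrow> mpoly_eval (case_prod x) H \<noteq> 0 \<Longrightarrow> point_of ns x \<in> V"
proof -
  obtain S where S: "S \<subseteq> (\<Union>d. multihomogeneous ns d)"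
    "multiproj_points ns - V = multiproj_zeros ns S"
    using assms(1) unfolding multiproj_open_def by blast
  have P: "point_of ns x0 \<in> multiproj_points ns"
    using assms(2) point_of_in_points by blast
  then have "point_of ns x0 \<notin> multiproj_zeros ns S"
    using S(2) assms(3) by blast
  then obtain H y where H: "H \<in> S" "y \<in> multiproj_coords ns (point_of ns x0)"
    "mpoly_eval (case_prod y) H \<noteq> 0"
    using P unfolding multiproj_zeros_def by blast
  obtain d where d: "H \<in> multihomogeneous ns d" using S(1) H(1) by blast
  have "mpoly_eval (case_prod x0) H \<noteq> 0"
    using multiproj_vanish_indep[OF P d valid_in_coords[OF assms(2)] H(2)] H(3) by blast
  moreover have "point_of ns x \<in> V"
    if "valid_coords ns x" "mpoly_eval (case_prod x) H \<noteq> 0" for x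
  proof -
    have "point_of ns x \<notin> multiproj_zeros ns S"
      using H(1) that valid_in_coords unfolding multiproj_zeros_def by blast
    then show ?thesis using S(2) point_of_in_points[OF that(1)] by blast
  qed
  ultimately show thesis using that by blast
qed

section \<open>Affine charts and coordinate ratios\<close>

lemma eval_coordinate:
  "mpoly_eval (case_prod x) (Poly_Mapping.single (Poly_Mapping.single (j, k) 1) 1) = x j k"
  by (simp add: mpoly_eval_single)

lemma coordinate_multihomogeneous:
  assumes "j < length ms" "k \<le> ms ! j"
  shows "Poly_Mapping.single (Poly_Mapping.single (j, k) 1) 1
    \<in> multihomogeneous ms (\<lambda>i. if i = j then 1 else 0)"
  using assms by (auto simp: multihomogeneous_def lookup_single when_def)

text \<open>The quotient is the same for all representatives, so the choice is harmless. Being a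
  function of the point, it can be pulled back along a morphism as a section of the structure
  sheaf.\<close>

definition coord_ratio :: "(nat \<Rightarrow> complex) set \<Rightarrow> nat \<Rightarrow> nat \<Rightarrow> complex" where
  "coord_ratio p l k = (let v = (SOME v. v \<in> p) in v k / v l)"

lemma coord_ratio_proj_class:
  assumes "v \<in> punctured_space n"
  shows "coord_ratio (proj_class n v) l k = v k / v l"
proof -
  define w where "w = (SOME w. w \<in> proj_class n v)"
  have "w \<in> proj_class n v"
    unfolding w_def by (rule someI[of "\<lambda>w. w \<in> proj_class n v"], rule self_mem_proj_class[OF assms])
  then obtain c where "c \<noteq> 0" "w = (\<lambda>j. c * v j)"
    using mem_proj_class[OF assms] by blast
  then show ?thesis by (simp add: coord_ratio_def w_def[symmetric] Let_def)
qed

lemma chart_open: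
  assumes "j < length ms" "l \<le> ms ! j"
  defines "V \<equiv> {Q \<in> multiproj_points ms. \<forall>y\<in>multiproj_coords ms Q. y j l \<noteq> 0}"
  shows "multiproj_open ms V"
    and "valid_coords ms y \<Longrightarrow> point_of ms y \<in> V \<longleftrightarrow> y j l \<noteq> 0"
proof -
  let ?F = "Poly_Mapping.single (Poly_Mapping.single (j, l) 1) 1
    :: (nat \<times> nat \<Rightarrow>\<^sub>0 nat) \<Rightarrow>\<^sub>0 complex"
  note hom = coordinate_multihomogeneous[OF assms(1,2)]
  have indep: "z j l \<noteq> 0" if "Q \<in> multiproj_points ms" "y \<in> multiproj_coords ms Q"
    "z \<in> multiproj_coords ms Q" "y j l \<noteq> 0" for Q y z
    using multiproj_vanish_indep[OF that(1) hom that(3) that(2), unfolded eval_coordinate] that(4)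
    by blast
  have "multiproj_points ms - V = multiproj_zeros ms {?F}"
  proof (rule set_eqI)
    fix Q
    have "Q \<in> multiproj_zeros ms {?F} \<longleftrightarrow>
      Q \<in> multiproj_points ms \<and> (\<forall>x\<in>multiproj_coords ms Q. x j l = 0)"
      unfolding multiproj_zeros_def mem_Collect_eq ball_simps(7) eval_coordinate by simp
    then show "Q \<in> multiproj_points ms - V \<longleftrightarrow> Q \<in> multiproj_zeros ms {?F}"
      unfolding V_def using indep multiproj_coords_nonempty by blast
  qed
  moreover have "{?F} \<subseteq> (\<Union>d. multihomogeneous ms d)" using hom by blast
  ultimately show "multiproj_open ms V"
    unfolding multiproj_open_def V_def by blast
  show "point_of ms y \<in> V \<longleftrightarrow> y j l \<noteq> 0" if "valid_coords ms y"
    using indep[OF point_of_in_points[OF that] valid_in_coords[OF that]]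
      point_of_in_points[OF that] valid_in_coords[OF that]
    unfolding V_def by blast
qed

lemma coord_ratio_regular:
  assumes "j < length ms" "l \<le> ms ! j" "k \<le> ms ! j"
  shows "(\<lambda>Q. coord_ratio (Q j) l k) \<in> multiproj_regular ms
    {Q \<in> multiproj_points ms. \<forall>y\<in>multiproj_coords ms Q. y j l \<noteq> 0}" (is "_ \<in> multiproj_regular ms ?V")
proof -
  let ?X = "\<lambda>k. Poly_Mapping.single (Poly_Mapping.single (j, k) 1) 1
    :: (nat \<times> nat \<Rightarrow>\<^sub>0 nat) \<Rightarrow>\<^sub>0 complex"
  have "mpoly_eval (case_prod x) (?X l) \<noteq> 0 \<and>
      coord_ratio (Q j) l k = mpoly_eval (case_prod x) (?X k) / mpoly_eval (case_prod x) (?X l)"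
    if "Q \<in> ?V" "x \<in> multiproj_coords ms Q" for Q x
  proof -
    have Q: "valid_coords ms x" "Q = point_of ms x"
      using coords_valid that by auto
    have xp: "x j \<in> punctured_space (ms ! j)" using Q(1) assms(1) by (simp add: valid_coords_def)
    have "coord_ratio (Q j) l k = x j k / x j l"
      unfolding Q(2) point_of_apply[OF assms(1)] by (rule coord_ratio_proj_class[OF xp])
    then show ?thesis using that unfolding eval_coordinate by blast
  qed
  then have "\<exists>d. \<exists>F\<in>multihomogeneous ms d. \<exists>G\<in>multihomogeneous ms d.
        \<forall>Q\<in>?V. \<forall>x\<in>multiproj_coords ms Q.
          mpoly_eval (case_prod x) G \<noteq> 0 \<and>
          coord_ratio (Q j) l k = mpoly_eval (case_prod x) F / mpoly_eval (case_prod x) G"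
    using coordinate_multihomogeneous[OF assms(1,2)] coordinate_multihomogeneous[OF assms(1,3)]
    by blast
  then show ?thesis
    unfolding multiproj_regular_def using chart_open(1)[OF assms(1,2)] by blast
qed

lemma morphism_maps_points:
  assumes "variety_morphism (multiprojective_space ns) (multiprojective_space ms) \<phi>"
    "P \<in> multiproj_points ns"
  shows "\<phi> P \<in> multiproj_points ms"
  using assms continuous_map_image_subset_topspace unfolding variety_morphism_def by fastforce

text \<open>The affine coordinates on the chart \<open>l\<close> are regular, so their pullbacks are
  locally fractions of polynomials; together they form a representative of the \<open>j\<close>-th
  component. The normalization at \<open>l\<close> is recorded because the Jacobians are taken in
  this chart.\<close>

lemma morphism_local_rep_chart:
  assumes mor: "variety_morphism (multiprojective_space ns) (multiprojective_space ms) \<phi>"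
    and x0: "valid_coords ns x0" and j: "j < length ms"
    and l: "l \<le> ms ! j" and u: "u \<in> \<phi> (point_of ns x0) j" "u l \<noteq> 0"
  shows "\<exists>F G H. (\<forall>k\<le>ms ! j. mpoly_eval (case_prod x0) (H k) \<noteq> 0) \<and>
    (\<forall>x. valid_coords ns x \<and> (\<forall>k\<le>ms ! j. mpoly_eval (case_prod x) (H k) \<noteq> 0) \<longrightarrow>
      (\<forall>k\<le>ms ! j. mpoly_eval (case_prod x) (G k) \<noteq> 0) \<and>
      mpoly_eval (case_prod x) (F l) / mpoly_eval (case_prod x) (G l) = 1 \<and>
      (\<lambda>k. if k \<le> ms ! j then mpoly_eval (case_prod x) (F k) / mpoly_eval (case_prod x) (G k) else 0)
        \<in> \<phi> (point_of ns x) j)"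
proof -
  have \<phi>p: "\<phi> (point_of ns x) \<in> multiproj_points ms" if "valid_coords ns x" for x
    using morphism_maps_points[OF mor] point_of_in_points[OF that] by blast
  obtain y0 where y0: "valid_coords ms y0" "\<phi> (point_of ns x0) = point_of ms y0"
    using point_obtain_coords[OF \<phi>p[OF x0]] by blast
  have "y0 j \<in> punctured_space (ms ! j)" using y0(1) j by (simp add: valid_coords_def)
  then have y0l: "y0 j l \<noteq> 0"
    using u mem_proj_class[of "y0 j" "ms ! j" u] y0(2) by (auto simp: point_of_apply[OF j])
  define V where "V = {Q \<in> multiproj_points ms. \<forall>y\<in>multiproj_coords ms Q. y j l \<noteq> 0}"
  define U where "U = {P \<in> multiproj_points ns. \<phi> P \<in> V}"
  note V = chart_open[OF j l, folded V_def]
  have x0U: "point_of ns x0 \<in> U"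
    unfolding U_def using V(2)[OF y0(1)] y0(2) y0l point_of_in_points[OF x0] by simp
  have "\<exists>F G H. mpoly_eval (case_prod x0) H \<noteq> 0 \<and>
    (\<forall>x. valid_coords ns x \<and> mpoly_eval (case_prod x) H \<noteq> 0 \<longrightarrow>
      point_of ns x \<in> U \<and> mpoly_eval (case_prod x) G \<noteq> 0 \<and>
      coord_ratio (\<phi> (point_of ns x) j) l k =
        mpoly_eval (case_prod x) F / mpoly_eval (case_prod x) G)"
    if k: "k \<le> ms ! j" for k
  proof -
    \<comment> \<open>The sheaf condition on morphisms is used here: \<open>U\<close> is the
      preimage of the chart \<open>V\<close>, on which the ratio is regular.\<close>
    have "(\<lambda>Q. coord_ratio (Q j) l k) \<circ> \<phi> \<in> multiproj_regular ns U"
      using mor V(1) coord_ratio_regular[OF j l k, folded V_def]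
      unfolding variety_morphism_def U_def
      by (auto simp: multiprojective_space_def[of ms] multiprojective_space_def[of ns]
        topspace_multiprojective_space[of ns, unfolded multiprojective_space_def, simplified]
        openin_multiprojective_space[of ms, unfolded multiprojective_space_def, simplified])
    then obtain W F G where W: "multiproj_open ns W" "point_of ns x0 \<in> W" "W \<subseteq> U"
      "\<And>Q x. Q \<in> W \<Longrightarrow> x \<in> multiproj_coords ns Q \<Longrightarrow>
          mpoly_eval (case_prod x) G \<noteq> 0 \<and>
          ((\<lambda>Q. coord_ratio (Q j) l k) \<circ> \<phi>) Q = mpoly_eval (case_prod x) F / mpoly_eval (case_prod x) G"
      using x0U unfolding multiproj_regular_def by blast
    obtain H where H: "mpoly_eval (case_prod x0) H \<noteq> 0"
      "\<And>x. valid_coords ns x \<Longrightarrow> mpoly_eval (case_prod x) H \<noteq> 0 \<Longrightarrow> point_of ns x \<in> W"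
      using multiproj_open_basic[OF W(1) x0 W(2)] by blast
    show ?thesis
      by (rule exI[of _ F], rule exI[of _ G], rule exI[of _ H])
        (use H W(3) W(4)[OF H(2) valid_in_coords] in auto)
  qed
  then obtain F G H where FGH: "\<And>k. k \<le> ms ! j \<Longrightarrow> mpoly_eval (case_prod x0) (H k) \<noteq> 0"
    "\<And>k x. k \<le> ms ! j \<Longrightarrow> valid_coords ns x \<Longrightarrow> mpoly_eval (case_prod x) (H k) \<noteq> 0 \<Longrightarrow>
      point_of ns x \<in> U \<and> mpoly_eval (case_prod x) (G k) \<noteq> 0 \<and>
      coord_ratio (\<phi> (point_of ns x) j) l k =
        mpoly_eval (case_prod x) (F k) / mpoly_eval (case_prod x) (G k)"
    by metis
  show ?thesis
  proof (rule exI[of _ F], rule exI[of _ G], rule exI[of _ H], intro conjI allI impI)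
    fix x assume "valid_coords ns x \<and> (\<forall>k\<le>ms ! j. mpoly_eval (case_prod x) (H k) \<noteq> 0)"
    then have x: "valid_coords ns x" "\<And>k. k \<le> ms ! j \<Longrightarrow> mpoly_eval (case_prod x) (H k) \<noteq> 0"
      by auto
    show "mpoly_eval (case_prod x) (G k) \<noteq> 0" if "k \<le> ms ! j" for k
      using FGH(2)[OF that x(1) x(2)[OF that]] by blast
    obtain y where y: "valid_coords ms y" "\<phi> (point_of ns x) = point_of ms y"
      using point_obtain_coords[OF \<phi>p[OF x(1)]] by blast
    have yj: "y j \<in> punctured_space (ms ! j)" using y(1) j by (simp add: valid_coords_def)
    have "point_of ms y \<in> V"
      using FGH(2)[OF l x(1) x(2)[OF l]] unfolding U_def y(2)[symmetric] by blast
    then have yl: "y j l \<noteq> 0" using V(2)[OF y(1)] by blast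
    have rat: "mpoly_eval (case_prod x) (F k) / mpoly_eval (case_prod x) (G k) = y j k / y j l"
      if "k \<le> ms ! j" for k
      using FGH(2)[OF that x(1) x(2)[OF that]]
      unfolding y(2) point_of_apply[OF j] coord_ratio_proj_class[OF yj] by simp
    show "mpoly_eval (case_prod x) (F l) / mpoly_eval (case_prod x) (G l) = 1"
      using rat[OF l] yl by simp
    \<comment> \<open>The vector of fractions is the representative \<open>y j\<close>, rescaled to
      have coordinate \<open>l\<close> equal to 1.\<close>
    have "(\<lambda>k. if k \<le> ms ! j then mpoly_eval (case_prod x) (F k) / mpoly_eval (case_prod x) (G k) else 0)
      = (\<lambda>k. (1 / y j l) * y j k)"
      using rat yj by (auto simp: punctured_space_def)
    then show "(\<lambda>k. if k \<le> ms ! j then mpoly_eval (case_prod x) (F k) / mpoly_eval (case_prod x) (G k) else 0)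
        \<in> \<phi> (point_of ns x) j"
      unfolding y(2) point_of_apply[OF j] mem_proj_class[OF yj] using yl
      by (intro exI[of _ "1 / y j l"]) simp
  qed (use l FGH in auto)
qed

lemma morphism_local_rep:
  assumes mor: "variety_morphism (multiprojective_space ns) (multiprojective_space ms) \<phi>"
    and x0: "valid_coords ns x0" and j: "j < length ms"
  shows "\<exists>F G H. (\<forall>k\<le>ms ! j. mpoly_eval (case_prod x0) (H k) \<noteq> 0) \<and>
    (\<forall>x. valid_coords ns x \<and> (\<forall>k\<le>ms ! j. mpoly_eval (case_prod x) (H k) \<noteq> 0) \<longrightarrow>
      (\<forall>k\<le>ms ! j. mpoly_eval (case_prod x) (G k) \<noteq> 0) \<and>
      (\<lambda>k. if k \<le> ms ! j then mpoly_eval (case_prod x) (F k) / mpoly_eval (case_prod x) (G k) else 0)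
        \<in> \<phi> (point_of ns x) j)"
proof -
  obtain y where y: "valid_coords ms y" "\<phi> (point_of ns x0) = point_of ms y"
    using point_obtain_coords[OF morphism_maps_points[OF mor point_of_in_points[OF x0]]] .
  have yj: "y j \<in> punctured_space (ms ! j)" using y(1) j by (simp add: valid_coords_def)
  then obtain l where l: "l \<le> ms ! j" "y j l \<noteq> 0"
    unfolding punctured_space_def by (force simp: not_le[symmetric])
  have "y j \<in> \<phi> (point_of ns x0) j"
    unfolding y(2) point_of_apply[OF j] by (rule self_mem_proj_class[OF yj])
  from morphism_local_rep_chart[OF mor x0 j l(1) this l(2)] show ?thesis by blast
qed

section \<open>Families of points over the projective line\<close>

text \<open>A parameter \<open>(t, s\<^sub>0, s\<^sub>1)\<close> consists of a real deformation parameter and homogeneous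
  coordinates on the projective line.\<close>

type_synonym param = "real \<times> complex \<times> complex"

definition params :: "param set" where
  "params = {q. snd q \<noteq> 0}"

text \<open>Joint continuity feeds the tube lemma and the closedness arguments; holomorphy along
  complex lines at fixed real parameter feeds Liouville's theorem. No theory of several complex
  variables is involved.\<close>

definition hol_on :: "param set \<Rightarrow> (param \<Rightarrow> complex) \<Rightarrow> bool" where
  "hol_on N f \<longleftrightarrow> continuous_on N f \<and>
     (\<forall>t a0 a1 b0 b1. (\<lambda>z. f (t, a0 + z * b0, a1 + z * b1))
        holomorphic_on {z. (t, a0 + z * b0, a1 + z * b1) \<in> N})"

text \<open>A curve in projective space need not have one nowhere vanishing lift that is constant or
  homogeneous over the whole line, so lifts are only required locally. The scaling clause says that
  \<open>c\<close> descends to the projective line.\<close>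

definition hol_family :: "nat list \<Rightarrow> (param \<Rightarrow> nat \<Rightarrow> (nat \<Rightarrow> complex) set) \<Rightarrow> bool" where
  "hol_family ns c \<longleftrightarrow>
     (\<forall>q\<in>params. \<exists>N x. open N \<and> q \<in> N \<and> N \<subseteq> params \<and>
        (\<forall>p\<in>N. valid_coords ns (x p) \<and> c p = point_of ns (x p)) \<and>
        (\<forall>i j. hol_on N (\<lambda>p. x p i j))) \<and>
     (\<forall>t a b z. z \<noteq> 0 \<longrightarrow> c (t, z * a, z * b) = c (t, a, b))"

section \<open>Closure properties of holomorphic dependence\<close>

lemma open_params: "open params"
  unfolding params_def by (intro open_Collect_neq continuous_intros)

lemma params_iff: "(t, a, b) \<in> params \<longleftrightarrow> a \<noteq> 0 \<or> b \<noteq> 0"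
  by (auto simp: params_def zero_prod_def)

lemma hol_on_subset: "hol_on N f \<Longrightarrow> M \<subseteq> N \<Longrightarrow> hol_on M f"
  unfolding hol_on_def
  by (blast intro: continuous_on_subset holomorphic_on_subset)

lemma hol_on_cong: "hol_on N f \<Longrightarrow> (\<And>q. q \<in> N \<Longrightarrow> g q = f q) \<Longrightarrow> hol_on N g"
  unfolding hol_on_def
  by (auto cong: continuous_on_cong) (metis (no_types, lifting) holomorphic_transform mem_Collect_eq)

lemma hol_on_const: "hol_on N (\<lambda>q. c)"
  by (simp add: hol_on_def)

lemma hol_on_fst: "hol_on N (\<lambda>q. of_real (fst q))"
  by (auto simp: hol_on_def intro!: continuous_intros)

lemma hol_on_snd_fst: "hol_on N (\<lambda>q. fst (snd q))"
  by (auto simp: hol_on_def intro!: continuous_intros holomorphic_intros)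

lemma hol_on_snd_snd: "hol_on N (\<lambda>q. snd (snd q))"
  by (auto simp: hol_on_def intro!: continuous_intros holomorphic_intros)

lemma hol_on_add: "hol_on N f \<Longrightarrow> hol_on N g \<Longrightarrow> hol_on N (\<lambda>q. f q + g q)"
  by (auto simp: hol_on_def intro!: continuous_intros holomorphic_intros)

lemma hol_on_mult: "hol_on N f \<Longrightarrow> hol_on N g \<Longrightarrow> hol_on N (\<lambda>q. f q * g q)"
  by (auto simp: hol_on_def intro!: continuous_intros holomorphic_intros)

lemma hol_on_divide:
  "hol_on N f \<Longrightarrow> hol_on N g \<Longrightarrow> (\<And>q. q \<in> N \<Longrightarrow> g q \<noteq> 0) \<Longrightarrow> hol_on N (\<lambda>q. f q / g q)"
  by (auto simp: hol_on_def intro!: continuous_intros holomorphic_intros)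

lemma hol_on_sum: "(\<And>i. i \<in> I \<Longrightarrow> hol_on N (f i)) \<Longrightarrow> hol_on N (\<lambda>q. \<Sum>i\<in>I. f i q)"
  by (induction I rule: infinite_finite_induct) (auto intro: hol_on_const hol_on_add)

lemma hol_on_prod: "(\<And>i. i \<in> I \<Longrightarrow> hol_on N (f i)) \<Longrightarrow> hol_on N (\<lambda>q. \<Prod>i\<in>I. f i q)"
  by (induction I rule: infinite_finite_induct) (auto intro: hol_on_const hol_on_mult)

lemma hol_on_power: "hol_on N f \<Longrightarrow> hol_on N (\<lambda>q. f q ^ n)"
  by (induction n) (auto intro: hol_on_const hol_on_mult)

lemma hol_on_mpoly_eval:
  assumes "\<And>i j. hol_on N (\<lambda>q. x q i j)"
  shows "hol_on N (\<lambda>q. mpoly_eval (case_prod (x q)) F)"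
  unfolding mpoly_eval_def
  by (intro hol_on_sum hol_on_mult hol_on_const hol_on_prod hol_on_power)
    (auto simp: case_prod_beta intro: assms)

text \<open>On open sets continuity and holomorphy are both pointwise conditions. This glues the
  coordinate ratios of a family, which are computed from varying local lifts.\<close>

lemma hol_on_local:
  assumes "open N" "\<And>q. q \<in> N \<Longrightarrow> \<exists>M. open M \<and> q \<in> M \<and> M \<subseteq> N \<and> hol_on M f"
  shows "hol_on N f"
  unfolding hol_on_def
proof (intro conjI allI)
  show "continuous_on N f"
  proof (rule continuous_at_imp_continuous_on, rule ballI)
    fix q assume "q \<in> N"
    then obtain M where "open M" "q \<in> M" "hol_on M f" using assms(2) by blast
    then show "isCont f q"
      unfolding hol_on_def by (simp add: continuous_on_eq_continuous_at)
  qed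
  fix t :: real and a0 a1 b0 b1 :: complex
  let ?p = "\<lambda>z. (t, a0 + z * b0, a1 + z * b1)"
  have op: "open {z. ?p z \<in> M}" if "open M" for M
  proof -
    have "continuous_on UNIV ?p" by (intro continuous_intros)
    then have "open (?p -` M)" using that by (rule open_vimage[rotated])
    then show ?thesis by (simp add: vimage_def)
  qed
  show "(\<lambda>z. f (?p z)) holomorphic_on {z. ?p z \<in> N}"
    unfolding holomorphic_on_open[OF op[OF assms(1)]]
  proof
    fix z assume "z \<in> {z. ?p z \<in> N}"
    then obtain M where M: "open M" "?p z \<in> M" "hol_on M f" using assms(2) by blast
    then have "(\<lambda>z. f (?p z)) holomorphic_on {z. ?p z \<in> M}" unfolding hol_on_def by blast
    then show "\<exists>f'. ((\<lambda>z. f (?p z)) has_field_derivative f') (at z)"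
      using holomorphic_on_open[OF op[OF M(1)]] M(2) by auto
  qed
qed

lemma hol_on_nonzero_open:
  assumes "open N" "hol_on N f"
  shows "open {q \<in> N. f q \<noteq> 0}"
proof -
  have "open (f -` (- {0}) \<inter> N)"
    using assms unfolding hol_on_def
    by (subst Int_commute) (intro continuous_open_preimage, auto)
  moreover have "f -` (- {0}) \<inter> N = {q \<in> N. f q \<noteq> 0}" by auto
  ultimately show ?thesis by simp
qed

section \<open>Families of curves and their images under morphisms\<close>

lemma hol_family_local:
  assumes "hol_family ns c" "q \<in> params"
  obtains N x where "open N" "q \<in> N" "N \<subseteq> params"
    "\<And>p. p \<in> N \<Longrightarrow> valid_coords ns (x p)" "\<And>p. p \<in> N \<Longrightarrow> c p = point_of ns (x p)"
    "\<And>i j. hol_on N (\<lambda>p. x p i j)"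
proof -
  have "\<exists>N x. open N \<and> q \<in> N \<and> N \<subseteq> params \<and>
        (\<forall>p\<in>N. valid_coords ns (x p) \<and> c p = point_of ns (x p)) \<and>
        (\<forall>i j. hol_on N (\<lambda>p. x p i j))"
    using assms unfolding hol_family_def by blast
  then show thesis using that by blast
qed

lemma hol_family_scale: "hol_family ns c \<Longrightarrow> z \<noteq> 0 \<Longrightarrow> c (t, z * a, z * b) = c (t, a, b)"
  unfolding hol_family_def by blast

lemma hol_family_point: "hol_family ns c \<Longrightarrow> q \<in> params \<Longrightarrow> c q \<in> multiproj_points ns"
  using hol_family_local point_of_in_points by metis

lemma hol_family_lift:
  assumes "\<And>q. q \<in> params \<Longrightarrow> valid_coords ns (x q)" "\<And>i j. hol_on params (\<lambda>q. x q i j)"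
    "\<And>t a b z. z \<noteq> 0 \<Longrightarrow> point_of ns (x (t, z * a, z * b)) = point_of ns (x (t, a, b))"
  shows "hol_family ns (\<lambda>q. point_of ns (x q))"
  unfolding hol_family_def
proof (intro conjI ballI allI impI)
  fix q assume "q \<in> params"
  then show "\<exists>N y. open N \<and> q \<in> N \<and> N \<subseteq> params \<and>
        (\<forall>p\<in>N. valid_coords ns (y p) \<and> point_of ns (x p) = point_of ns (y p)) \<and>
        (\<forall>i j. hol_on N (\<lambda>p. y p i j))"
    using assms(1,2) open_params by blast
qed (use assms(3) in blast)

lemma hol_family_const:
  assumes "P \<in> multiproj_points ns"
  shows "hol_family ns (\<lambda>q. P)"
proof -
  obtain x where "valid_coords ns x" "P = point_of ns x"
    using point_obtain_coords[OF assms] .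
  then show ?thesis
    using hol_family_lift[of ns "\<lambda>q. x"] by (simp add: hol_on_const)
qed

text \<open>Substitute a local lift of \<open>c\<close> into the polynomial fractions that represent
  the morphism near the given point. This is possible where finitely many continuous functions do
  not vanish, hence near the given parameter.\<close>

lemma hol_family_morphism:
  assumes mor: "variety_morphism (multiprojective_space ns) (multiprojective_space ms) \<phi>"
    and c: "hol_family ns c"
  shows "hol_family ms (\<lambda>q. \<phi> (c q))"
  unfolding hol_family_def
proof (intro conjI ballI allI impI)
  fix q assume q: "q \<in> params"
  have "\<exists>N x. open N \<and> q \<in> N \<and> N \<subseteq> params \<and>
        (\<forall>p\<in>N. valid_coords ns (x p) \<and> c p = point_of ns (x p)) \<and>
        (\<forall>i j. hol_on N (\<lambda>p. x p i j))"
    using c q unfolding hol_family_def by blast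
  then obtain N x where N: "open N" "q \<in> N" "N \<subseteq> params"
    and x0: "\<forall>p\<in>N. valid_coords ns (x p) \<and> c p = point_of ns (x p)"
      "\<forall>i j. hol_on N (\<lambda>p. x p i j)"
    by blast
  have x: "\<And>p. p \<in> N \<Longrightarrow> valid_coords ns (x p)" "\<And>p. p \<in> N \<Longrightarrow> c p = point_of ns (x p)"
      "\<And>i j. hol_on N (\<lambda>p. x p i j)"
    using x0 by auto
  let ?e = "\<lambda>p F. mpoly_eval (case_prod (x p)) F"
  define rep where "rep j F G H \<longleftrightarrow> (\<forall>k\<le>ms ! j. ?e q (H k) \<noteq> 0) \<and>
      (\<forall>y. valid_coords ns y \<and> (\<forall>k\<le>ms ! j. mpoly_eval (case_prod y) (H k) \<noteq> 0) \<longrightarrow>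
      (\<forall>k\<le>ms ! j. mpoly_eval (case_prod y) (G k) \<noteq> 0) \<and>
      (\<lambda>k. if k \<le> ms ! j then mpoly_eval (case_prod y) (F k) / mpoly_eval (case_prod y) (G k) else 0)
        \<in> \<phi> (point_of ns y) j)" for j F G H
  have "\<exists>F G H. rep j F G H" if "j < length ms" for j
    using morphism_local_rep[OF mor x(1)[OF N(2)] that] unfolding rep_def by blast
  then obtain F G H where FGH: "\<And>j. j < length ms \<Longrightarrow> rep j (F j) (G j) (H j)"
    by metis
  have H: "\<And>j k. j < length ms \<Longrightarrow> k \<le> ms ! j \<Longrightarrow> ?e q (H j k) \<noteq> 0"
    and FG: "\<And>j y. j < length ms \<Longrightarrow> valid_coords ns y \<Longrightarrow>
      (\<And>k. k \<le> ms ! j \<Longrightarrow> mpoly_eval (case_prod y) (H j k) \<noteq> 0) \<Longrightarrow>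
      (\<forall>k\<le>ms ! j. mpoly_eval (case_prod y) (G j k) \<noteq> 0) \<and>
      (\<lambda>k. if k \<le> ms ! j then mpoly_eval (case_prod y) (F j k) / mpoly_eval (case_prod y) (G j k) else 0)
        \<in> \<phi> (point_of ns y) j"
    using FGH unfolding rep_def by blast+
  define M where "M = N \<inter> (\<Inter>j<length ms. \<Inter>k\<le>ms ! j. {p \<in> N. ?e p (H j k) \<noteq> 0})"
  \<comment> \<open>The default 0 beyond \<open>ms ! j\<close> is what
    \<open>punctured_space\<close> demands; for factor indices out of range it keeps every entry
    holomorphic.\<close>
  define y where "y = (\<lambda>p j k. if j < length ms \<and> k \<le> ms ! j then ?e p (F j k) / ?e p (G j k) else 0)"
  have "open M"
    unfolding M_def
    by (intro open_Int open_INT N(1) ballI hol_on_nonzero_open hol_on_mpoly_eval x(3)) auto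
  have MN: "M \<subseteq> N" by (auto simp: M_def)
  have HM: "?e p (H j k) \<noteq> 0" if "p \<in> M" "j < length ms" "k \<le> ms ! j" for p j k
    using that by (auto simp: M_def)
  have "q \<in> M" using N(2) H by (auto simp: M_def)
  have y: "?e p (G j k) \<noteq> 0" "y p j \<in> \<phi> (c p) j"
    if "p \<in> M" "j < length ms" "k \<le> ms ! j" for p j k
  proof -
    have p: "p \<in> N" using that MN by blast
    have f: "(\<forall>k\<le>ms ! j. ?e p (G j k) \<noteq> 0) \<and>
      (\<lambda>k. if k \<le> ms ! j then ?e p (F j k) / ?e p (G j k) else 0) \<in> \<phi> (point_of ns (x p)) j"
      by (rule FG[OF that(2) x(1)[OF p]]) (rule HM[OF that(1,2)])
    have "y p j = (\<lambda>k. if k \<le> ms ! j then ?e p (F j k) / ?e p (G j k) else 0)"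
      using that by (auto simp: y_def)
    then show "?e p (G j k) \<noteq> 0" "y p j \<in> \<phi> (c p) j"
      using f that(3) x(2)[OF p] by auto
  qed
  have yv: "valid_coords ms (y p) \<and> \<phi> (c p) = point_of ms (y p)" if p: "p \<in> M" for p
  proof -
    have "\<phi> (c p) \<in> multiproj_points ms"
      using morphism_maps_points[OF mor] hol_family_point[OF c] N(3) MN p by blast
    moreover have "y p \<in> multiproj_coords ms (\<phi> (c p))"
      using y(2)[OF p] by (auto simp: multiproj_coords_def)
    ultimately show ?thesis using coords_valid by blast
  qed
  have yh: "hol_on M (\<lambda>p. y p j k)" for j k
  proof (cases "j < length ms \<and> k \<le> ms ! j")
    case True
    then have "hol_on M (\<lambda>p. ?e p (F j k) / ?e p (G j k))"
      using y(1) by (intro hol_on_divide hol_on_mpoly_eval hol_on_subset[OF x(3) MN]) auto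
    then show ?thesis using True by (simp add: y_def)
  next
    case False
    then have "(\<lambda>p. y p j k) = (\<lambda>p. 0)" by (auto simp: y_def)
    then show ?thesis using hol_on_const[of M 0] by simp
  qed
  show "\<exists>M y. open M \<and> q \<in> M \<and> M \<subseteq> params \<and>
        (\<forall>p\<in>M. valid_coords ms (y p) \<and> \<phi> (c p) = point_of ms (y p)) \<and>
        (\<forall>i j. hol_on M (\<lambda>p. y p i j))"
    using \<open>open M\<close> \<open>q \<in> M\<close> MN N(3) yv yh by (intro exI[of _ M] exI[of _ y]) auto
qed (simp add: hol_family_scale[OF c])

text \<open>Locally, equality of the two components means that finitely many continuous minors
  vanish. Two families and two parameters are allowed, so that one statement covers both the
  comparison of two points of a moving curve and the comparison with a fixed point.\<close>

lemma hol_family_closed_eq: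
  assumes c: "hol_family ns c" and d: "hol_family ns d" and j: "j < length ns"
    and s: "s \<noteq> 0" and s': "s' \<noteq> 0"
  shows "closed {t. c (t, s) j = d (t, s') j}"
proof -
  have "open {t. c (t, s) j \<noteq> d (t, s') j}"
    unfolding open_subopen[of "{t. c (t, s) j \<noteq> d (t, s') j}"]
  proof (intro ballI)
    fix t assume "t \<in> {t. c (t, s) j \<noteq> d (t, s') j}"
    then have ne: "c (t, s) j \<noteq> d (t, s') j" by simp
    have p: "(t, s) \<in> params" "(t, s') \<in> params" using s s' by (auto simp: params_def)
    obtain N x where N: "open N" "(t, s) \<in> N"
      and x: "\<And>p. p \<in> N \<Longrightarrow> valid_coords ns (x p)" "\<And>p. p \<in> N \<Longrightarrow> c p = point_of ns (x p)"
        "\<And>i j. hol_on N (\<lambda>p. x p i j)"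
      using hol_family_local[OF c p(1)] by metis
    obtain M y where M: "open M" "(t, s') \<in> M"
      and y: "\<And>p. p \<in> M \<Longrightarrow> valid_coords ns (y p)" "\<And>p. p \<in> M \<Longrightarrow> d p = point_of ns (y p)"
        "\<And>i j. hol_on M (\<lambda>p. y p i j)"
      using hol_family_local[OF d p(2)] by metis
    have eq: "c (u, s) j = d (u, s') j \<longleftrightarrow> (\<forall>a\<le>ns ! j. \<forall>b\<le>ns ! j.
        x (u, s) j a * y (u, s') j b = x (u, s) j b * y (u, s') j a)"
      if "(u, s) \<in> N" "(u, s') \<in> M" for u
    proof -
      have "x (u, s) j \<in> punctured_space (ns ! j)" "y (u, s') j \<in> punctured_space (ns ! j)"
        using x(1)[OF that(1)] y(1)[OF that(2)] j by (auto simp: valid_coords_def)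
      then show ?thesis
        using x(2)[OF that(1)] y(2)[OF that(2)] point_of_apply[OF j] proj_class_eq_iff_minors
        by simp
    qed
    \<comment> \<open>One nonzero minor witnesses the inequality and stays nonzero for nearby
      parameters.\<close>
    obtain a b where ab: "a \<le> ns ! j" "b \<le> ns ! j"
      "x (t, s) j a * y (t, s') j b \<noteq> x (t, s) j b * y (t, s') j a"
      using eq[OF N(2) M(2)] ne by blast
    define A where "A = (\<lambda>u. (u, s)) -` N \<inter> (\<lambda>u. (u, s')) -` M"
    have "open A"
      unfolding A_def by (intro open_Int open_vimage N M continuous_intros)
    have cx: "continuous_on A (\<lambda>u. x (u, s) j a)" for a
    proof -
      have "continuous_on N (\<lambda>p. x p j a)" using x(3) unfolding hol_on_def by blast
      then have "continuous_on A ((\<lambda>p. x p j a) \<circ> (\<lambda>u. (u, s)))"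
        by (intro continuous_on_compose continuous_intros) (auto simp: A_def elim: continuous_on_subset)
      then show ?thesis by (simp add: o_def)
    qed
    have cy: "continuous_on A (\<lambda>u. y (u, s') j a)" for a
    proof -
      have "continuous_on M (\<lambda>p. y p j a)" using y(3) unfolding hol_on_def by blast
      then have "continuous_on A ((\<lambda>p. y p j a) \<circ> (\<lambda>u. (u, s')))"
        by (intro continuous_on_compose continuous_intros) (auto simp: A_def elim: continuous_on_subset)
      then show ?thesis by (simp add: o_def)
    qed
    define D where "D = (\<lambda>u. x (u, s) j a * y (u, s') j b - x (u, s) j b * y (u, s') j a)"
    have "open (D -` (- {0}) \<inter> A)"
      unfolding D_def
      by (subst Int_commute, rule continuous_open_preimage)
        (intro continuous_intros cx cy, use \<open>open A\<close> in auto)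
    moreover have "t \<in> D -` (- {0}) \<inter> A" using ab(3) N(2) M(2) by (auto simp: D_def A_def)
    moreover have "D -` (- {0}) \<inter> A \<subseteq> {t. c (t, s) j \<noteq> d (t, s') j}"
      using eq ab(1,2) by (auto simp: D_def A_def)
    ultimately show "\<exists>T. open T \<and> t \<in> T \<and> T \<subseteq> {t. c (t, s) j \<noteq> d (t, s') j}" by blast
  qed
  then show ?thesis by (simp add: closed_def Collect_neg_eq)
qed

text \<open>Near a contracted curve, the chart \<open>v\<^sub>l \<noteq> 0\<close> contains the whole nearby curves by the tube
  lemma; in it, the coordinate ratios are bounded entire functions on every affine line in
  \<open>\<complex>\<^sup>2\<close> that misses the origin.\<close>

lemma rigidity_local:
  assumes c: "hol_family ns c" and j: "j < length ns"
    and const: "\<And>s s'. s \<noteq> 0 \<Longrightarrow> s' \<noteq> 0 \<Longrightarrow> c (t0, s) j = c (t0, s') j"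
  shows "\<exists>T. open T \<and> t0 \<in> T \<and> (\<forall>t\<in>T. \<forall>s s'. s \<noteq> 0 \<longrightarrow> s' \<noteq> 0 \<longrightarrow> c (t, s) j = c (t, s') j)"
proof -
  have coord: "\<exists>x. valid_coords ns x \<and> c q = point_of ns x" if "q \<in> params" for q
    using hol_family_point[OF c that] point_obtain_coords by metis
  obtain x0 where x0: "valid_coords ns x0" "c (t0, (1, 0)) = point_of ns x0"
    using coord[of "(t0, (1, 0))"] by (auto simp: params_iff)
  obtain l where l: "l \<le> ns ! j" "x0 j l \<noteq> 0"
    using x0(1) j unfolding valid_coords_def punctured_space_def by (force simp: not_le[symmetric])
  \<comment> \<open>\<open>W\<close> collects the parameters whose \<open>j\<close>-th component
    lies in the chart of \<open>l\<close>, and \<open>h k\<close> is the \<open>k\<close>-th affine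
    coordinate there.\<close>
  define W where "W = {q \<in> params. \<exists>v\<in>c q j. v l \<noteq> 0}"
  define h where "h k q = coord_ratio (c q j) l k" for k q
  have Wx: "q \<in> W \<longleftrightarrow> x j l \<noteq> 0" if "q \<in> params" "valid_coords ns x" "c q = point_of ns x" for q x
  proof -
    have "x j \<in> punctured_space (ns ! j)" using that(2) j by (simp add: valid_coords_def)
    then show ?thesis
      using that self_mem_proj_class[of "x j" "ns ! j"] mem_proj_class[of "x j" "ns ! j"]
      by (auto simp: W_def point_of_apply[OF j])
  qed
  have hx: "h k q = x j k / x j l" if "valid_coords ns x" "c q = point_of ns x" for k q x
    using that j by (simp add: h_def point_of_apply coord_ratio_proj_class valid_coords_def)
  have loc: "\<exists>M. open M \<and> q \<in> M \<and> M \<subseteq> W \<and> hol_on M (h k)" if q: "q \<in> W" for q k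
  proof -
    have qp: "q \<in> params" using q by (simp add: W_def)
    obtain N x where N: "open N" "q \<in> N" "N \<subseteq> params"
      and x: "\<And>p. p \<in> N \<Longrightarrow> valid_coords ns (x p)" "\<And>p. p \<in> N \<Longrightarrow> c p = point_of ns (x p)"
        "\<And>i j. hol_on N (\<lambda>p. x p i j)"
      using hol_family_local[OF c qp] by metis
    let ?M = "{p \<in> N. x p j l \<noteq> 0}"
    have "open ?M" by (rule hol_on_nonzero_open[OF N(1) x(3)])
    moreover have "q \<in> ?M" using Wx[OF qp x(1,2)] q N(2) by auto
    moreover have "?M \<subseteq> W" using Wx x(1,2) N(3) by blast
    moreover have "hol_on ?M (h k)"
    proof (rule hol_on_cong)
      show "hol_on ?M (\<lambda>p. x p j k / x p j l)"
        by (intro hol_on_divide hol_on_subset[OF x(3)]) auto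
      show "h k p = x p j k / x p j l" if "p \<in> ?M" for p
        using that hx x(1,2) by blast
    qed
    ultimately show ?thesis by blast
  qed
  have oW: "open W"
    unfolding open_subopen[of W] using loc[of _ 0] by blast
  have hW: "hol_on W (h k)" for k
    by (rule hol_on_local[OF oW loc])
  have t0W: "(t0, s) \<in> W" if "s \<noteq> 0" for s
  proof -
    have p: "(t0, s) \<in> params" using that by (simp add: params_def)
    have "c (t0, s) j = c (t0, (1, 0)) j"
      using const[OF that, of "(1, 0)"] by (simp add: zero_prod_def)
    then have "x0 j \<in> c (t0, s) j"
      using x0 j by (simp add: point_of_apply self_mem_proj_class valid_coords_def)
    then show ?thesis using l(2) p unfolding W_def by blast
  qed
  \<comment> \<open>Every point of the projective line has a representative of norm 1, so
    \<open>K\<close> is a compact substitute for it inside the parameter space.\<close>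
  define K :: "(complex \<times> complex) set" where "K = sphere 0 1"
  have K: "compact K" "0 \<notin> K" by (auto simp: K_def)
  have "{t0} \<times> K \<subseteq> W"
  proof
    fix p assume p: "p \<in> {t0} \<times> K"
    then have "snd p \<noteq> 0" using K(2) by auto
    then show "p \<in> W" using t0W[of "snd p"] p by auto
  qed
  then have "\<exists>T. open T \<and> t0 \<in> T \<and> T \<times> K \<subseteq> W"
    using Elementary_Topology.tube_lemma[OF K(1) oW] by blast
  then obtain T where T: "open T" "t0 \<in> T" "T \<times> K \<subseteq> W" by blast
  have "c (t, s) j = c (t, s') j" if t: "t \<in> T" and s: "s \<noteq> 0" and s': "s' \<noteq> 0" for t s s'
  proof -
    have norm: "\<exists>u\<in>K. c (t, s) = c (t, u)" if "s \<noteq> 0" for s :: "complex \<times> complex"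
    proof -
      obtain a b where ab: "s = (a, b)" by (cases s)
      let ?r = "complex_of_real (1 / norm s)"
      have "(?r * a, ?r * b) = (1 / norm s) *\<^sub>R s"
        by (simp add: ab scaleR_conv_of_real)
      then have "(?r * a, ?r * b) \<in> K" using that by (simp add: K_def)
      moreover have "c (t, (?r * a, ?r * b)) = c (t, s)"
        unfolding ab by (rule hol_family_scale[OF c]) (use that ab in simp)
      ultimately show ?thesis by metis
    qed
    have tW: "(t, s) \<in> W" if s0: "s \<noteq> 0" for s
    proof -
      obtain u where u: "u \<in> K" "c (t, s) = c (t, u)" using norm[OF s0] by blast
      then have "(t, u) \<in> W" using T(3) t by blast
      then show ?thesis using u(2) s0 by (auto simp: W_def params_def)
    qed
    \<comment> \<open>\<open>h k\<close> is invariant under scaling of \<open>s\<close>, so its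
      bound on the sphere holds for all nonzero \<open>s\<close>.\<close>
    have bdd: "\<exists>B. \<forall>s. s \<noteq> 0 \<longrightarrow> cmod (h k (t, s)) \<le> B" for k
    proof -
      have "(\<lambda>s. (t, s)) ` K \<subseteq> W" using T(3) t by auto
      then have "continuous_on ((\<lambda>s. (t, s)) ` K) (h k)"
        using hW[of k] continuous_on_subset unfolding hol_on_def by blast
      then have "continuous_on K (h k \<circ> (\<lambda>s. (t, s)))"
        by (intro continuous_on_compose continuous_intros)
      then have "bounded ((h k \<circ> (\<lambda>s. (t, s))) ` K)"
        by (rule compact_imp_bounded[OF compact_continuous_image[OF _ K(1)]])
      then obtain B where B: "\<forall>u\<in>K. cmod (h k (t, u)) \<le> B"
        by (auto simp: bounded_iff)
      have "cmod (h k (t, s)) \<le> B" if s0: "s \<noteq> 0" for s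
      proof -
        obtain u where u: "u \<in> K" "c (t, s) = c (t, u)" using norm[OF s0] by blast
        then show ?thesis using B unfolding h_def by simp
      qed
      then show ?thesis by blast
    qed
    have line: "h k (t, (a0 + z * b0, a1 + z * b1)) = h k (t, (a0, a1))"
      if "\<And>z. (a0 + z * b0, a1 + z * b1) \<noteq> 0" for k a0 a1 b0 b1 z
    proof -
      let ?f = "\<lambda>z. h k (t, (a0 + z * b0, a1 + z * b1))"
      have "{z. (t, a0 + z * b0, a1 + z * b1) \<in> W} = UNIV" using tW that by auto
      moreover have "?f holomorphic_on {z. (t, a0 + z * b0, a1 + z * b1) \<in> W}"
        using hW[of k] unfolding hol_on_def by blast
      ultimately have "?f holomorphic_on UNIV" by simp
      moreover have "bounded (range ?f)" using bdd[of k] that by (auto simp: bounded_iff)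
      ultimately have "?f constant_on UNIV" by (rule Liouville_theorem)
      then obtain e where e: "\<And>z. ?f z = e" unfolding constant_on_def by blast
      show ?thesis using e[of z] e[of 0] by simp
    qed
    obtain a0 a1 b0 b1 where ab: "s = (a0, a1)" "s' = (b0, b1)" by (cases s, cases s')
    show ?thesis
    proof (cases "a0 * b1 = a1 * b0")
      case True
      then obtain z where z: "z \<noteq> 0" "b0 = z * a0" "b1 = z * a1"
      proof (cases "a0 = 0")
        case True
        then have "a1 \<noteq> 0" "b0 = 0" "b1 \<noteq> 0" using s s' \<open>a0 * b1 = a1 * b0\<close> ab by (auto simp: zero_prod_def)
        then show ?thesis using that[of "b1 / a1"] True by simp
      next
        case False
        then have "b1 = b0 / a0 * a1" using \<open>a0 * b1 = a1 * b0\<close> by (simp add: field_simps)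
        moreover have "b0 \<noteq> 0"
          using calculation s' ab by (auto simp: zero_prod_def)
        ultimately show ?thesis using that[of "b0 / a0"] False by simp
      qed
      then show ?thesis unfolding ab using hol_family_scale[OF c z(1)] by simp
    next
      case False
      \<comment> \<open>For independent \<open>s\<close> and \<open>s'\<close>, the line through
        \<open>s\<close> in direction \<open>s'\<close> and the line through \<open>s'\<close> in
        direction \<open>s\<close> both miss the origin. They meet in \<open>s + s'\<close>, which
        links the two values of \<open>h k\<close>.\<close>
      have nz1: "(a0 + z * b0, a1 + z * b1) \<noteq> 0" for z
      proof
        assume "(a0 + z * b0, a1 + z * b1) = 0"
        then have "a0 = - z * b0" "a1 = - z * b1" by (auto simp: zero_prod_def add_eq_0_iff)
        then show False using False by (simp add: mult_ac)
      qed
      have nz2: "(b0 + z * a0, b1 + z * a1) \<noteq> 0" for z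
      proof
        assume "(b0 + z * a0, b1 + z * a1) = 0"
        then have "b0 = - z * a0" "b1 = - z * a1" by (auto simp: zero_prod_def add_eq_0_iff)
        then show False using False by (simp add: mult_ac)
      qed
      have heq: "h k (t, s) = h k (t, s')" for k
        using line[OF nz1, of k 1] line[OF nz2, of k 1] by (simp add: ab add.commute)
      have p: "(t, s) \<in> params" "(t, s') \<in> params" using s s' by (auto simp: params_def)
      obtain x where x: "valid_coords ns x" "c (t, s) = point_of ns x" using coord[OF p(1)] by blast
      obtain y where y: "valid_coords ns y" "c (t, s') = point_of ns y" using coord[OF p(2)] by blast
      have xl: "x j l \<noteq> 0" using Wx[OF p(1) x] tW[OF s] by blast
      have yl: "y j l \<noteq> 0" using Wx[OF p(2) y] tW[OF s'] by blast
      have e: "x j k / x j l = y j k / y j l" for k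
        using heq[of k] hx[OF x] hx[OF y] by simp
      have "x j a * y j b = x j b * y j a" for a b
      proof -
        have xy: "x j k = x j l / y j l * y j k" for k
          using e[of k] xl yl by (simp add: field_simps)
        show ?thesis by (subst xy[of a], subst xy[of b]) simp
      qed
      then show ?thesis
        using x y j by (simp add: point_of_apply valid_coords_def proj_class_eq_iff_minors)
    qed
  qed
  then show ?thesis using T by blast
qed

text \<open>The parameters with contracted curve form a set that is closed by
  \<open>hol_family_closed_eq\<close>, open by \<open>rigidity_local\<close>, and contains 0; the
  real line is connected.\<close>

lemma rigidity:
  assumes c: "hol_family ns c" and j: "j < length ns"
    and const: "\<And>s s'. s \<noteq> 0 \<Longrightarrow> s' \<noteq> 0 \<Longrightarrow> c (0, s) j = c (0, s') j"
    and s: "s \<noteq> 0" and s': "s' \<noteq> 0"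
  shows "c (t, s) j = c (t, s') j"
proof -
  define S where "S = {t. \<forall>s s'. s \<noteq> 0 \<longrightarrow> s' \<noteq> 0 \<longrightarrow> c (t, s) j = c (t, s') j}"
  have "S = (\<Inter>s\<in>-{0}. \<Inter>s'\<in>-{0}. {t. c (t, s) j = c (t, s') j})"
    unfolding S_def by blast
  moreover have "closed \<dots>"
    by (intro closed_INT ballI hol_family_closed_eq[OF c c j]) auto
  ultimately have "closed S" by simp
  moreover have "open S"
    unfolding open_subopen[of S]
  proof
    fix t assume "t \<in> S"
    then have "\<And>s s'. s \<noteq> 0 \<Longrightarrow> s' \<noteq> 0 \<Longrightarrow> c (t, s) j = c (t, s') j" unfolding S_def by blast
    from rigidity_local[OF c j this] show "\<exists>T. open T \<and> t \<in> T \<and> T \<subseteq> S" unfolding S_def by blast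
  qed
  moreover have "0 \<in> S" using const unfolding S_def by blast
  ultimately have "S = UNIV" using clopen[of S] by auto
  then show ?thesis using s s' unfolding S_def by blast
qed

section \<open>Contracted curves\<close>

text \<open>The linear map \<open>w \<mapsto> w + t \<ell>(w) v\<close> with \<open>\<ell>(w) = a w\<^sub>l + b w\<^sub>k\<close>; it is a transvection
  when \<open>\<ell>(v) = 0\<close>.\<close>

definition transvection ::
    "complex \<Rightarrow> complex \<Rightarrow> nat \<Rightarrow> nat \<Rightarrow> (nat \<Rightarrow> complex) \<Rightarrow> complex \<Rightarrow> (nat \<Rightarrow> complex) \<Rightarrow> nat \<Rightarrow> complex" where
  "transvection a b l k v t w = (\<lambda>m. w m + t * (a * w l + b * w k) * v m)"

text \<open>The linear form is preserved because it vanishes on \<open>v\<close>. If the image of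
  \<open>w\<close> is 0, the form vanishes at \<open>w\<close>, so the transvection fixes
  \<open>w\<close> and \<open>w = 0\<close>.\<close>

lemma transvection_punctured:
  assumes w: "w \<in> punctured_space n" and v: "\<And>m. m > n \<Longrightarrow> v m = 0" "a * v l + b * v k = 0"
  shows "transvection a b l k v t w \<in> punctured_space n"
proof (rule ccontr)
  assume "\<not> ?thesis"
  then have z: "w m + t * (a * w l + b * w k) * v m = 0" for m
    using w v(1) unfolding punctured_space_def transvection_def by auto
  let ?L = "a * w l + b * w k"
  have "?L = a * (w l + t * ?L * v l) + b * (w k + t * ?L * v k) - t * ?L * (a * v l + b * v k)"
    by (simp add: algebra_simps)
  then have "?L = 0" by (simp only: z v(2)) simp
  then have "w m = 0" for m using z[of m] by simp
  then show False using w by (simp add: punctured_space_def)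
qed

text \<open>Points are sets of vectors, so the induced map on points is the image of a set; by
  linearity it sends classes to classes.\<close>

lemma transvection_image:
  assumes w: "w \<in> punctured_space n" and v: "\<And>m. m > n \<Longrightarrow> v m = 0" "a * v l + b * v k = 0"
  shows "transvection a b l k v t ` proj_class n w = proj_class n (transvection a b l k v t w)"
proof -
  have lin: "transvection a b l k v t (\<lambda>m. c * w m) = (\<lambda>m. c * transvection a b l k v t w m)" for c
    by (simp add: transvection_def algebra_simps)
  have "proj_class n w = (\<lambda>c m. c * w m) ` (- {0})"
    using mem_proj_class[OF w] by auto
  moreover have "proj_class n (transvection a b l k v t w)
      = (\<lambda>c m. c * transvection a b l k v t w m) ` (- {0})"
    using mem_proj_class[OF transvection_punctured[OF w v]] by auto
  ultimately show ?thesis by (simp add: image_image lin)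
qed

lemma hol_family_transvection:
  assumes c: "hol_family ns c" and i: "i < length ns"
    and v: "\<And>m. m > ns ! i \<Longrightarrow> v m = 0" "a * v l + b * v k = 0"
  shows "hol_family ns (\<lambda>q. (c q)(i := transvection a b l k v (of_real (fst q)) ` c q i))"
    (is "hol_family ns ?d")
  unfolding hol_family_def
proof (intro conjI ballI allI impI)
  fix q assume "q \<in> params"
  then have "\<exists>N x. open N \<and> q \<in> N \<and> N \<subseteq> params \<and>
        (\<forall>p\<in>N. valid_coords ns (x p) \<and> c p = point_of ns (x p)) \<and>
        (\<forall>i j. hol_on N (\<lambda>p. x p i j))"
    using c unfolding hol_family_def by blast
  then obtain N x where N: "open N" "q \<in> N" "N \<subseteq> params"
    and x: "\<forall>p\<in>N. valid_coords ns (x p) \<and> c p = point_of ns (x p)"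
      "\<forall>i j. hol_on N (\<lambda>p. x p i j)"
    by blast
  define y where "y p = (x p)(i := transvection a b l k v (of_real (fst p)) (x p i))" for p
  have "valid_coords ns (y p) \<and> ?d p = point_of ns (y p)" if p: "p \<in> N" for p
  proof -
    have xi: "x p i \<in> punctured_space (ns ! i)" using x(1) p i by (auto simp: valid_coords_def)
    have "?d p = point_of ns (y p)"
      using x(1) p i unfolding y_def
      by (simp add: point_of_apply transvection_image[OF xi v] point_of_update)
    moreover have "valid_coords ns (y p)"
      unfolding y_def using x(1) p transvection_punctured[OF xi v]
      by (intro valid_coords_update) auto
    ultimately show ?thesis by blast
  qed
  moreover have "hol_on N (\<lambda>p. y p i' j)" for i' j
  proof (cases "i' = i")
    case True
    have "hol_on N (\<lambda>p. x p i j + of_real (fst p) * (a * x p i l + b * x p i k) * v j)"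
      by (intro hol_on_add hol_on_mult hol_on_const hol_on_fst) (use x(2) in auto)
    then show ?thesis by (simp add: y_def True transvection_def)
  next
    case False
    then show ?thesis using x(2) by (simp add: y_def)
  qed
  ultimately show "\<exists>N y. open N \<and> q \<in> N \<and> N \<subseteq> params \<and>
        (\<forall>p\<in>N. valid_coords ns (y p) \<and> ?d p = point_of ns (y p)) \<and>
        (\<forall>i j. hol_on N (\<lambda>p. y p i j))"
    using N by (intro exI[of _ N] exI[of _ y]) auto
qed (simp add: hol_family_scale[OF c])

text \<open>A transvection fixing \<open>x\<^sub>i\<close> and moving \<open>y\<^sub>i\<close> carries the contracted curve to a curve that is
  still contracted, to the same value. This reaches all \<open>w\<close> with \<open>\<ell>(w) \<noteq> 0\<close>, and the remaining
  \<open>w\<close> as limits \<open>t \<rightarrow> 0\<close> of \<open>w + t y\<^sub>i\<close>.\<close>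

lemma contracted_point_independent:
  assumes mor: "variety_morphism (multiprojective_space ns) (multiprojective_space ms) \<phi>"
    and i: "i < length ns" and j: "j < length ms"
    and c: "hol_family ns c" and stat: "\<And>t s. c (t, s) = c (0, s)"
    and const: "\<And>s s'. s \<noteq> 0 \<Longrightarrow> s' \<noteq> 0 \<Longrightarrow> \<phi> (c (0, s)) j = \<phi> (c (0, s')) j"
    and s: "s \<noteq> 0" "c (0, s) = point_of ns x" "valid_coords ns x"
    and s': "s' \<noteq> 0" "c (0, s') = point_of ns y" "valid_coords ns y"
    and ne: "c (0, s) i \<noteq> c (0, s') i" and w: "w \<in> punctured_space (ns ! i)"
  shows "\<phi> (point_of ns (y(i := w))) j = \<phi> (point_of ns y) j"
proof -
  have xi: "x i \<in> punctured_space (ns ! i)" using s(3) i by (auto simp: valid_coords_def)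
  have yi: "y i \<in> punctured_space (ns ! i)" using s'(3) i by (auto simp: valid_coords_def)
  obtain k l where kl: "x i k * y i l \<noteq> x i l * y i k"
    using ne proj_class_eq_iff_minors[OF xi yi] unfolding s(2) s'(2) point_of_apply[OF i] by blast
  \<comment> \<open>Cramer's rule: the coefficients \<open>a\<close> and \<open>b\<close> give the
    linear form in the coordinates \<open>l\<close> and \<open>k\<close> with value 0 at
    \<open>x i\<close> and 1 at \<open>y i\<close>.\<close>
  define D where "D = x i k * y i l - x i l * y i k"
  define a where "a = x i k / D"
  define b where "b = - (x i l / D)"
  have D: "D \<noteq> 0" using kl by (simp add: D_def)
  have Lx: "a * x i l + b * x i k = 0" by (simp add: a_def b_def)
  have Ly: "a * y i l + b * y i k = 1"
  proof -
    have "a * y i l + b * y i k = (x i k * y i l - x i l * y i k) / D"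
      by (simp add: a_def b_def diff_divide_distrib)
    then show ?thesis using D by (simp add: D_def)
  qed
  have step1: "\<phi> (point_of ns (y(i := (\<lambda>m. y i m + v m)))) j = \<phi> (point_of ns y) j"
    if v: "\<And>m. m > ns ! i \<Longrightarrow> v m = 0" "a * v l + b * v k = 0" for v
  proof -
    let ?T = "transvection a b l k v"
    define d where "d q = (c q)(i := ?T (of_real (fst q)) ` c q i)" for q
    have d: "hol_family ns d"
      unfolding d_def by (rule hol_family_transvection[OF c i v])
    have d0: "d (0, r) = c (0, r)" for r
    proof -
      have "?T 0 = id" by (auto simp: transvection_def)
      then show ?thesis by (simp add: d_def)
    qed
    have "\<phi> (d (0, r)) j = \<phi> (d (0, r')) j" if "r \<noteq> 0" "r' \<noteq> 0" for r r'
      unfolding d0 using that by (rule const)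
    then have "\<phi> (d (1, s)) j = \<phi> (d (1, s')) j"
      by (rule rigidity[OF hol_family_morphism[OF mor d] j _ s(1) s'(1)])
    moreover have "d (1, s) = c (0, s)"
    proof -
      have T: "?T 1 (x i) = x i" using Lx by (simp add: transvection_def)
      have "d (1, s) = (c (0, s))(i := ?T 1 ` c (0, s) i)"
        using stat[of 1 s] by (simp add: d_def)
      also have "?T 1 ` c (0, s) i = c (0, s) i"
        using transvection_image[OF xi v, of 1] T by (simp add: s(2) point_of_apply[OF i])
      finally show ?thesis by simp
    qed
    moreover have "d (1, s') = point_of ns (y(i := (\<lambda>m. y i m + v m)))"
    proof -
      have T: "?T 1 (y i) = (\<lambda>m. y i m + v m)" using Ly by (simp add: transvection_def)
      have "d (1, s') = (c (0, s'))(i := ?T 1 ` c (0, s') i)"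
        using stat[of 1 s'] by (simp add: d_def)
      also have "?T 1 ` c (0, s') i = proj_class (ns ! i) (\<lambda>m. y i m + v m)"
        using transvection_image[OF yi v, of 1] T by (simp add: s'(2) point_of_apply[OF i])
      finally show ?thesis unfolding s'(2) point_of_update[OF i] .
    qed
    moreover have "\<phi> (c (0, s)) j = \<phi> (point_of ns y) j"
      using const[OF s(1) s'(1)] s'(2) by simp
    ultimately show ?thesis by simp
  qed
  have step2: "\<phi> (point_of ns (y(i := w))) j = \<phi> (point_of ns y) j"
    if w: "w \<in> punctured_space (ns ! i)" and Lw: "a * w l + b * w k \<noteq> 0" for w
  proof -
    \<comment> \<open>Rescaling \<open>w\<close> to give the form the value 1, as at
      \<open>y i\<close>, puts the difference \<open>?v\<close> into its kernel; then
      \<open>step1\<close> applies.\<close>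
    let ?z = "1 / (a * w l + b * w k)"
    let ?v = "\<lambda>m. ?z * w m - y i m"
    have "a * ?v l + b * ?v k = ?z * (a * w l + b * w k) - (a * y i l + b * y i k)"
      by (simp only: algebra_simps)
    then have "a * ?v l + b * ?v k = 0" using Lw Ly by simp
    moreover have "?v m = 0" if "m > ns ! i" for m
      using that w yi by (simp add: punctured_space_def)
    ultimately have "\<phi> (point_of ns (y(i := (\<lambda>m. y i m + ?v m)))) j = \<phi> (point_of ns y) j"
      by (intro step1)
    moreover have "point_of ns (y(i := (\<lambda>m. y i m + ?v m))) = point_of ns (y(i := w))"
      using proj_class_scale[of ?z "ns ! i" w] Lw
      by (intro point_of_cong) auto
    ultimately show ?thesis by simp
  qed
  show ?thesis
  proof (cases "a * w l + b * w k = 0")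
    case False
    then show ?thesis using step2 w by blast
  next
    case True
    have ne: "proj_class (ns ! i) w \<noteq> proj_class (ns ! i) (y i)"
    proof
      assume "proj_class (ns ! i) w = proj_class (ns ! i) (y i)"
      then obtain e where "y i = (\<lambda>m. e * w m)"
        using self_mem_proj_class[OF yi] mem_proj_class[OF w] by auto
      then have "a * y i l + b * y i k = e * (a * w l + b * w k)" by (simp add: algebra_simps)
      then show False using True Ly by simp
    qed
    \<comment> \<open>The path \<open>w + t y i\<close> is written as a family that is constant
      along the projective line, to make \<open>hol_family_closed_eq\<close> applicable. Along it
      the form has the value \<open>t\<close>, so only \<open>t = 0\<close> is left open by
      \<open>step2\<close>.\<close>
    let ?f = "\<lambda>q::param. y(i := (\<lambda>m. 1 * w m + of_real (fst q) * y i m))"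
    have fp: "(\<lambda>m. 1 * w m + z * y i m) \<in> punctured_space (ns ! i)" for z
      by (rule punctured_combination[OF w yi ne]) simp
    have f: "hol_family ns (\<lambda>q. point_of ns (?f q))"
    proof (rule hol_family_lift)
      show "valid_coords ns (?f q)" for q
        using s'(3) fp by (intro valid_coords_update)
      fix i' m
      have "hol_on params (\<lambda>q. 1 * w m + of_real (fst q) * y i m)"
        by (intro hol_on_add hol_on_mult hol_on_const hol_on_fst)
      then show "hol_on params (\<lambda>q. ?f q i' m)"
        by (cases "i' = i") (auto simp: hol_on_const)
    qed simp
    define A where "A = {t. \<phi> (point_of ns (?f (t, (1, 0)))) j = \<phi> (point_of ns y) j}"
    have "closed A"
      using hol_family_closed_eq[OF hol_family_morphism[OF mor f]
          hol_family_const[OF morphism_maps_points[OF mor point_of_in_points[OF s'(3)]]] j,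
          of "(1, 0)" "(1, 0)"]
      by (simp add: zero_prod_def A_def)
    moreover have "t \<in> A" if "t \<noteq> 0" for t
    proof -
      have "a * (1 * w l + of_real t * y i l) + b * (1 * w k + of_real t * y i k)
        = (a * w l + b * w k) + of_real t * (a * y i l + b * y i k)"
        by (simp add: algebra_simps)
      also have "\<dots> \<noteq> 0" using that True Ly by simp
      finally show ?thesis using step2[OF fp] by (simp add: A_def)
    qed
    ultimately have "open (- A)" "- A \<subseteq> {0}" by (auto simp: closed_def)
    then have "- A \<noteq> {0}" using not_open_singleton[of "0::real"] by metis
    then have "0 \<in> A" using \<open>- A \<subseteq> {0}\<close> by blast
    then show ?thesis by (simp add: A_def)
  qed
qed

text \<open>In the slice through \<open>y\<close> the component is already constant, so the line
  joining \<open>z i\<close> and \<open>w\<close> there is contracted. Sliding the remaining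
  coordinates from \<open>y\<close> to \<open>z\<close> deforms it into the line joining
  \<open>P\<close> and \<open>P(i := p)\<close>, and \<open>rigidity\<close> applies once
  more.\<close>

lemma contracted_imp_independent:
  assumes mor: "variety_morphism (multiprojective_space ns) (multiprojective_space ms) \<phi>"
    and i: "i < length ns" and j: "j < length ms"
    and c: "hol_family ns c" and stat: "\<And>t s. c (t, s) = c (0, s)"
    and const: "\<And>s s'. s \<noteq> 0 \<Longrightarrow> s' \<noteq> 0 \<Longrightarrow> \<phi> (c (0, s)) j = \<phi> (c (0, s')) j"
    and s: "s \<noteq> 0" and s': "s' \<noteq> 0" and ne: "c (0, s) i \<noteq> c (0, s') i"
    and P: "P \<in> multiproj_points ns" and p: "p \<in> projective_space (ns ! i)"
  shows "\<phi> (P(i := p)) j = \<phi> P j"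
proof -
  have pp: "(0, s) \<in> params" "(0, s') \<in> params" using s s' by (auto simp: params_def)
  obtain x where x: "valid_coords ns x" "c (0, s) = point_of ns x"
    using point_obtain_coords[OF hol_family_point[OF c pp(1)]] .
  obtain y where y: "valid_coords ns y" "c (0, s') = point_of ns y"
    using point_obtain_coords[OF hol_family_point[OF c pp(2)]] .
  have line: "\<phi> (point_of ns (y(i := w))) j = \<phi> (point_of ns y) j"
    if "w \<in> punctured_space (ns ! i)" for w
    by (rule contracted_point_independent[OF mor i j c stat _ s x(2,1) s' y(2,1) ne that]) (rule const)
  obtain z where z: "valid_coords ns z" "P = point_of ns z"
    using point_obtain_coords[OF P] .
  obtain w where w: "w \<in> punctured_space (ns ! i)" "p = proj_class (ns ! i) w"
    using projective_space_obtain[OF p] .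
  have zi: "z i \<in> punctured_space (ns ! i)" using z(1) i by (auto simp: valid_coords_def)
  show ?thesis
  proof (cases "proj_class (ns ! i) (z i) = proj_class (ns ! i) w")
    case True
    then show ?thesis using w(2) z(2) i by (simp add: point_of_apply fun_upd_idem)
  next
    case False
    \<comment> \<open>Interpolating between proportional vectors could pass through 0, for instance
      from \<open>- z m\<close> to \<open>z m\<close>. In that case \<open>y'\<close> takes
      \<open>z m\<close> itself, which represents the same point.\<close>
    define y' where "y' m = (if proj_class (ns ! m) (z m) = proj_class (ns ! m) (y m) then z m else y m)" for m
    define f where "f q = (\<lambda>m. if m = i then (\<lambda>h. fst (snd q) * z i h + snd (snd q) * w h)
      else if m < length ns then (\<lambda>h. of_real (1 - fst q) * y' m h + of_real (fst q) * z m h)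
      else (\<lambda>h. 0))" for q :: param
    have f: "hol_family ns (\<lambda>q. point_of ns (f q))"
    proof (rule hol_family_lift)
      show "valid_coords ns (f q)" if q: "q \<in> params" for q
        unfolding valid_coords_def
      proof (intro allI impI)
        fix m assume m: "m < length ns"
        have zm: "z m \<in> punctured_space (ns ! m)" and ym: "y m \<in> punctured_space (ns ! m)"
          using z(1) y(1) m by (auto simp: valid_coords_def)
        show "f q m \<in> punctured_space (ns ! m)"
        proof (cases "m = i")
          case True
          have "fst (snd q) \<noteq> 0 \<or> snd (snd q) \<noteq> 0"
            using q by (auto simp: params_def prod_eq_iff)
          then show ?thesis using punctured_combination[OF zi w(1) False] True by (simp add: f_def)
        next
          case mi: False
          show ?thesis
          proof (cases "proj_class (ns ! m) (z m) = proj_class (ns ! m) (y m)")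
            case True
            then have "f q m = z m" using mi m by (simp add: f_def y'_def algebra_simps)
            then show ?thesis using zm by simp
          next
            case False
            then have "f q m = (\<lambda>h. of_real (1 - fst q) * y m h + of_real (fst q) * z m h)"
              using mi m by (simp add: f_def y'_def)
            moreover have "\<dots> \<in> punctured_space (ns ! m)"
              by (rule punctured_combination[OF ym zm]) (use False in auto)
            ultimately show ?thesis by simp
          qed
        qed
      qed
      show "hol_on params (\<lambda>q. f q m h)" for m h
      proof -
        have "hol_on params (\<lambda>q. fst (snd q) * z i h + snd (snd q) * w h)"
          by (intro hol_on_add hol_on_mult hol_on_const hol_on_snd_fst hol_on_snd_snd)
        moreover have "hol_on params (\<lambda>q. (1 + (-1) * of_real (fst q)) * y' m h + of_real (fst q) * z m h)"
          by (intro hol_on_add hol_on_mult hol_on_const hol_on_fst)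
        ultimately show ?thesis
          by (cases "m = i"; cases "m < length ns") (simp_all add: f_def hol_on_const)
      qed
      show "point_of ns (f (t, e * a, e * b)) = point_of ns (f (t, a, b))" if "e \<noteq> 0" for t a b e
      proof (rule point_of_cong)
        fix m
        show "proj_class (ns ! m) (f (t, e * a, e * b) m) = proj_class (ns ! m) (f (t, a, b) m)"
          using proj_class_scale[OF that, of "ns ! m" "f (t, a, b) m"]
          by (cases "m = i") (simp_all add: f_def algebra_simps)
      qed
    qed
    have f0: "point_of ns (f (0, a, b)) = point_of ns (y(i := (\<lambda>h. a * z i h + b * w h)))" for a b
    proof (rule point_of_cong)
      fix m assume "m < length ns"
      then show "proj_class (ns ! m) (f (0, a, b) m)
          = proj_class (ns ! m) ((y(i := (\<lambda>h. a * z i h + b * w h))) m)"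
        by (simp add: f_def y'_def)
    qed
    \<comment> \<open>The curve at parameter 0 lies in the slice through \<open>y\<close>, where
      \<open>line\<close> gives the value of the component.\<close>
    have f0j: "\<phi> (point_of ns (f (0, q))) j = \<phi> (point_of ns y) j" if "q \<noteq> 0" for q
    proof -
      obtain a b where ab: "q = (a, b)" by (cases q)
      have "(\<lambda>h. a * z i h + b * w h) \<in> punctured_space (ns ! i)"
        using that by (intro punctured_combination[OF zi w(1) False]) (auto simp: ab zero_prod_def)
      from line[OF this] show ?thesis unfolding ab f0 .
    qed
    have "\<phi> (point_of ns (f (0, q))) j = \<phi> (point_of ns (f (0, q'))) j"
      if "q \<noteq> 0" "q' \<noteq> 0" for q q'
      using f0j[OF that(1)] f0j[OF that(2)] by simp
    then have "\<phi> (point_of ns (f (1, (0, 1)))) j = \<phi> (point_of ns (f (1, (1, 0)))) j"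
      by (rule rigidity[OF hol_family_morphism[OF mor f] j]) (simp_all add: zero_prod_def)
    moreover have "point_of ns (f (1, (1, 0))) = P"
      unfolding z(2) by (rule point_of_cong) (simp add: f_def)
    moreover have "point_of ns (f (1, (0, 1))) = P(i := p)"
      unfolding z(2) w(2) point_of_update[OF i] by (rule point_of_cong) (simp add: f_def)
    ultimately show ?thesis by simp
  qed
qed

section \<open>Dependence of components on factors\<close>

definition depends_on :: "nat list \<Rightarrow> ((nat \<Rightarrow> (nat \<Rightarrow> complex) set) \<Rightarrow> nat \<Rightarrow> 'a) \<Rightarrow> nat \<Rightarrow> nat \<Rightarrow> bool" where
  "depends_on ns \<phi> i j \<longleftrightarrow>
     (\<exists>P\<in>multiproj_points ns. \<exists>p\<in>projective_space (ns ! i). \<phi> (P(i := p)) j \<noteq> \<phi> P j)"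

lemma independent_update:
  "\<not> depends_on ns \<phi> i j \<Longrightarrow> P \<in> multiproj_points ns \<Longrightarrow> p \<in> projective_space (ns ! i)
    \<Longrightarrow> \<phi> (P(i := p)) j = \<phi> P j"
  by (auto simp: depends_on_def)

text \<open>If \<open>\<psi>\<^sub>i\<close> varies along a line in factor \<open>k \<noteq> j\<close>, then the image of this line under \<open>\<psi>\<close> is
  a curve that is contracted by \<open>\<phi>\<^sub>j\<close> but not by the projection to factor \<open>i\<close>.\<close>

lemma depends_on_imp_inverse_independent:
  assumes mor: "variety_morphism (multiprojective_space ns) (multiprojective_space ms) \<phi>"
    and mor': "variety_morphism (multiprojective_space ms) (multiprojective_space ns) \<psi>"
    and inv: "\<And>y. y \<in> multiproj_points ms \<Longrightarrow> \<phi> (\<psi> y) = y"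
    and i: "i < length ns" and j: "j < length ms" and k: "k < length ms" "k \<noteq> j"
    and dep: "depends_on ns \<phi> i j"
  shows "\<not> depends_on ms \<psi> k i"
proof
  assume "depends_on ms \<psi> k i"
  then obtain Q q where Q: "Q \<in> multiproj_points ms" and q: "q \<in> projective_space (ms ! k)"
    and ne: "\<psi> (Q(k := q)) i \<noteq> \<psi> Q i"
    unfolding depends_on_def by blast
  obtain y where y: "valid_coords ms y" "Q = point_of ms y"
    using point_obtain_coords[OF Q] .
  obtain w where w: "w \<in> punctured_space (ms ! k)" "q = proj_class (ms ! k) w"
    using projective_space_obtain[OF q] .
  have yk: "y k \<in> punctured_space (ms ! k)" using y(1) k by (auto simp: valid_coords_def)
  have distinct: "proj_class (ms ! k) (y k) \<noteq> proj_class (ms ! k) w"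
  proof
    assume "proj_class (ms ! k) (y k) = proj_class (ms ! k) w"
    then have "Q(k := q) = Q" using w(2) y(2) k by (simp add: point_of_apply fun_upd_idem)
    then show False using ne by simp
  qed
  \<comment> \<open>The line in factor \<open>k\<close> through \<open>Q\<close> at
    \<open>(1, 0)\<close> and \<open>Q(k := q)\<close> at \<open>(0, 1)\<close>, independent of the
    real parameter.\<close>
  define f where "f q = y(k := (\<lambda>m. fst (snd q) * y k m + snd (snd q) * w m))" for q :: param
  have fv: "valid_coords ms (f q)" if "q \<in> params" for q
  proof -
    have "fst (snd q) \<noteq> 0 \<or> snd (snd q) \<noteq> 0"
      using that by (auto simp: params_def prod_eq_iff)
    then show ?thesis
      unfolding f_def by (intro valid_coords_update y(1) punctured_combination[OF yk w(1) distinct])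
  qed
  have f: "hol_family ms (\<lambda>q. point_of ms (f q))"
  proof (rule hol_family_lift[OF fv])
    show "hol_on params (\<lambda>q. f q i' m)" for i' m
    proof -
      have "hol_on params (\<lambda>q. fst (snd q) * y k m + snd (snd q) * w m)"
        by (intro hol_on_add hol_on_mult hol_on_const hol_on_snd_fst hol_on_snd_snd)
      then show ?thesis by (cases "i' = k") (simp_all add: f_def hol_on_const)
    qed
    show "point_of ms (f (t, e * a, e * b)) = point_of ms (f (t, a, b))" if "e \<noteq> 0" for t a b e
    proof (rule point_of_cong)
      fix m
      show "proj_class (ms ! m) (f (t, e * a, e * b) m) = proj_class (ms ! m) (f (t, a, b) m)"
        using proj_class_scale[OF that, of "ms ! m" "f (t, a, b) m"]
        by (cases "m = k") (simp_all add: f_def algebra_simps)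
    qed
  qed
  define c where "c q = \<psi> (point_of ms (f q))" for q
  have c: "hol_family ns c"
    unfolding c_def by (rule hol_family_morphism[OF mor' f])
  have stat: "c (t, s) = c (0, s)" for t s
    by (simp add: c_def f_def)
  have cj: "\<phi> (c (0, s)) j = Q j" if "s \<noteq> 0" for s
  proof -
    have "(0, s) \<in> params" using that by (simp add: params_def)
    then have "\<phi> (c (0, s)) = point_of ms (f (0, s))"
      unfolding c_def by (intro inv point_of_in_points fv)
    then show ?thesis using y(2) j k by (simp add: f_def point_of_apply)
  qed
  have const: "\<phi> (c (0, s)) j = \<phi> (c (0, s')) j" if "s \<noteq> 0" "s' \<noteq> 0" for s s'
    using cj[OF that(1)] cj[OF that(2)] by simp
  have "c (0, (1, 0)) = \<psi> Q"
    by (simp add: c_def f_def y(2))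
  moreover have "c (0, (0, 1)) = \<psi> (Q(k := q))"
    using k by (simp add: c_def f_def y(2) w(2) point_of_update)
  ultimately have ne': "c (0, (1, 0)) i \<noteq> c (0, (0, 1)) i" using ne by simp
  \<comment> \<open>The curve \<open>c\<close> moves in factor \<open>i\<close> while its image
    under the \<open>j\<close>-th component stays at \<open>Q j\<close>, so that component cannot
    depend on factor \<open>i\<close>, contrary to \<open>dep\<close>.\<close>
  have "\<phi> (P(i := p)) j = \<phi> P j"
    if "P \<in> multiproj_points ns" "p \<in> projective_space (ns ! i)" for P p
    by (rule contracted_imp_independent[OF mor i j c stat _ _ _ ne' that], rule const)
      (simp_all add: zero_prod_def)
  then show False using dep unfolding depends_on_def by blast
qed

lemma independent_imp_constant:
  assumes indep: "\<And>k. k < length ms \<Longrightarrow> \<not> depends_on ms \<psi> k i"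
    and P: "P \<in> multiproj_points ms" and Q: "Q \<in> multiproj_points ms"
  shows "\<psi> P i = \<psi> Q i"
proof -
  \<comment> \<open>The hybrids lead from \<open>P\<close> to \<open>Q\<close> by replacing one
    coordinate at a time.\<close>
  define Z where "Z m = (\<lambda>k. if k < m then Q k else P k)" for m
  have Zp: "Z m \<in> multiproj_points ms" if "m \<le> length ms" for m
    using P Q that by (auto simp: Z_def multiproj_points_def PiE_iff extensional_def)
  have "\<psi> (Z m) i = \<psi> P i" if "m \<le> length ms" for m
    using that
  proof (induction m)
    case 0
    then show ?case by (simp add: Z_def)
  next
    case (Suc m)
    have Z: "Z (Suc m) = (Z m)(m := Q m)"
      by (rule ext) (simp add: Z_def less_Suc_eq)
    have "\<psi> (Z (Suc m)) i = \<psi> (Z m) i"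
      unfolding Z by (rule independent_update[OF indep Zp])
        (use Q Suc.prems in \<open>auto simp: multiproj_points_def PiE_iff\<close>)
    then show ?case using Suc by simp
  qed
  moreover have "Z (length ms) = Q"
  proof
    show "Z (length ms) k = Q k" for k
      using P Q by (cases "k < length ms") (simp_all add: Z_def multiproj_points_def PiE_iff extensional_def)
  qed
  ultimately show ?thesis by (metis order_refl)
qed

lemma multiproj_points_nonempty: "multiproj_points ns \<noteq> {}"
proof -
  have "(\<lambda>j. if j = 0 then 1 else 0) \<in> punctured_space k" for k
    by (auto simp: punctured_space_def)
  then have "valid_coords ns (\<lambda>_ j. if j = 0 then 1 else 0)" by (simp add: valid_coords_def)
  then show ?thesis using point_of_in_points by blast
qed

text \<open>The first two coordinate points are distinct, so at least one of them differs from
  \<open>p\<close>.\<close>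

lemma projective_space_other_point:
  assumes "k > 0"
  obtains q where "q \<in> projective_space k" "q \<noteq> p"
proof -
  let ?e = "\<lambda>(m::nat) j. if j = m then 1 else 0 :: complex"
  have e: "?e 0 \<in> punctured_space k" "?e 1 \<in> punctured_space k"
    using assms by (auto simp: punctured_space_def)
  have "proj_class k (?e 0) \<noteq> proj_class k (?e 1)"
  proof
    assume "proj_class k (?e 0) = proj_class k (?e 1)"
    then have "?e 0 0 * ?e 1 1 = ?e 0 1 * ?e 1 0"
      using proj_class_eq_iff_minors[OF e, THEN iffD1, rule_format, of 0 1] assms by simp
    then show False by simp
  qed
  then have "proj_class k (?e 0) \<noteq> p \<or> proj_class k (?e 1) \<noteq> p" by auto
  then show thesis
    using that[OF proj_class_in_projective_space[OF e(1)]] that[OF proj_class_in_projective_space[OF e(2)]]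
    by blast
qed

text \<open>Otherwise the \<open>i\<close>-th component of \<open>\<psi>\<close> would be constant,
  whereas \<open>\<psi>\<close> inverts \<open>\<phi>\<close> and thus reaches points that differ in
  factor \<open>i\<close>.\<close>

lemma depends_on_some_factor:
  assumes mor: "variety_morphism (multiprojective_space ns) (multiprojective_space ms) \<phi>"
    and inv: "\<And>x. x \<in> multiproj_points ns \<Longrightarrow> \<psi> (\<phi> x) = x"
    and i: "i < length ns" "ns ! i > 0"
  shows "\<exists>k<length ms. depends_on ms \<psi> k i"
proof (rule ccontr)
  assume "\<not> ?thesis"
  then have indep: "\<And>k. k < length ms \<Longrightarrow> \<not> depends_on ms \<psi> k i" by blast
  obtain P where P: "P \<in> multiproj_points ns" using multiproj_points_nonempty by blast
  obtain q where q: "q \<in> projective_space (ns ! i)" "q \<noteq> P i"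
    using projective_space_other_point[OF i(2)] .
  have Pq: "P(i := q) \<in> multiproj_points ns" using point_update_in_points P i(1) q(1) by blast
  have "\<psi> (\<phi> P) i = \<psi> (\<phi> (P(i := q))) i"
    by (rule independent_imp_constant[OF indep]) (use morphism_maps_points[OF mor] P Pq in auto)
  then show False using inv P Pq q(2) by simp
qed

section \<open>Jacobians\<close>

text \<open>Derivatives of functions on \<open>\<complex>\<^sup>n\<^sup>+\<^sup>1\<close> are described by the chain rule along all
  differentiable curves through a point.\<close>

definition curve_at :: "nat \<Rightarrow> (nat \<Rightarrow> complex) \<Rightarrow> (complex \<Rightarrow> nat \<Rightarrow> complex) \<Rightarrow> (nat \<Rightarrow> complex) \<Rightarrow> bool" where
  "curve_at n v g g' \<longleftrightarrow> g 0 = v \<and>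
     (\<forall>m. ((\<lambda>z. g z m) has_field_derivative g' m) (at 0)) \<and> (\<forall>m>n. g' m = 0)"

text \<open>Quantifying over curves makes the chain rule immediate: a map whose coordinates have
  gradients sends curves to curves, provided the target coordinates beyond the range stay
  constant.\<close>

definition has_gradient :: "nat \<Rightarrow> (nat \<Rightarrow> complex) \<Rightarrow> ((nat \<Rightarrow> complex) \<Rightarrow> complex) \<Rightarrow> (nat \<Rightarrow> complex) \<Rightarrow> bool" where
  "has_gradient n v F D \<longleftrightarrow> (\<forall>g g'. curve_at n v g g' \<longrightarrow>
     ((\<lambda>z. F (g z)) has_field_derivative (\<Sum>m\<le>n. D m * g' m)) (at 0))"

lemma has_gradient_const: "has_gradient n v (\<lambda>w. c) (\<lambda>m. 0)"
  by (simp add: has_gradient_def)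

lemma has_gradient_coordinate: "has_gradient n v (\<lambda>w. w k) (\<lambda>m. if m = k then 1 else 0)"
  unfolding has_gradient_def
proof (intro allI impI)
  fix g g' assume g: "curve_at n v g g'"
  have "(\<Sum>m\<le>n. (if m = k then 1 else 0) * g' m) = (\<Sum>m\<le>n. if m = k then g' m else 0)"
    by (rule sum.cong) auto
  also have "\<dots> = g' k"
    using g by (auto simp: curve_at_def)
  finally show "((\<lambda>z. g z k) has_field_derivative (\<Sum>m\<le>n. (if m = k then 1 else 0) * g' m)) (at 0)"
    using g by (simp add: curve_at_def)
qed

lemma has_gradient_add:
  assumes "has_gradient n v F D" "has_gradient n v G E"
  shows "has_gradient n v (\<lambda>w. F w + G w) (\<lambda>m. D m + E m)"
  unfolding has_gradient_def
proof (intro allI impI)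
  fix g g' assume g: "curve_at n v g g'"
  have "((\<lambda>z. F (g z) + G (g z)) has_field_derivative
      (\<Sum>m\<le>n. D m * g' m) + (\<Sum>m\<le>n. E m * g' m)) (at 0)"
    using assms g unfolding has_gradient_def by (intro DERIV_add) auto
  then show "((\<lambda>z. F (g z) + G (g z)) has_field_derivative (\<Sum>m\<le>n. (D m + E m) * g' m)) (at 0)"
    by (simp add: distrib_right sum.distrib)
qed

lemma has_gradient_mult:
  assumes "has_gradient n v F D" "has_gradient n v G E"
  shows "has_gradient n v (\<lambda>w. F w * G w) (\<lambda>m. D m * G v + E m * F v)"
  unfolding has_gradient_def
proof (intro allI impI)
  fix g g' assume g: "curve_at n v g g'"
  have g0: "g 0 = v" using g by (simp add: curve_at_def)
  have "((\<lambda>z. F (g z) * G (g z)) has_field_derivative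
      (\<Sum>m\<le>n. D m * g' m) * G (g 0) + (\<Sum>m\<le>n. E m * g' m) * F (g 0)) (at 0)"
    using assms g unfolding has_gradient_def by (intro DERIV_mult) auto
  moreover have "(\<Sum>m\<le>n. D m * g' m) * G (g 0) + (\<Sum>m\<le>n. E m * g' m) * F (g 0)
      = (\<Sum>m\<le>n. (D m * G v + E m * F v) * g' m)"
    by (simp add: g0 sum_distrib_left sum_distrib_right sum.distrib[symmetric] algebra_simps)
  ultimately show "((\<lambda>z. F (g z) * G (g z)) has_field_derivative
      (\<Sum>m\<le>n. (D m * G v + E m * F v) * g' m)) (at 0)"
    by simp
qed

lemma has_gradient_inverse:
  assumes "has_gradient n v F D" "F v \<noteq> 0"
  shows "has_gradient n v (\<lambda>w. inverse (F w)) (\<lambda>m. - (D m / (F v)\<^sup>2))"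
  unfolding has_gradient_def
proof (intro allI impI)
  fix g g' assume g: "curve_at n v g g'"
  have g0: "g 0 = v" using g by (simp add: curve_at_def)
  have F: "((\<lambda>z. F (g z)) has_field_derivative (\<Sum>m\<le>n. D m * g' m)) (at 0)"
    using assms(1) g unfolding has_gradient_def by blast
  have "((\<lambda>z. inverse (F (g z))) has_field_derivative
      - ((\<Sum>m\<le>n. D m * g' m) * inverse ((F (g 0))\<^sup>2))) (at 0)"
    using DERIV_inverse_fun[OF F] g0 assms(2) by (simp add: power2_eq_square mult_ac)
  moreover have "- ((\<Sum>m\<le>n. D m * g' m) * inverse ((F (g 0))\<^sup>2)) = (\<Sum>m\<le>n. - (D m / (F v)\<^sup>2) * g' m)"
    by (simp add: g0 sum_distrib_left sum_negf divide_inverse mult_ac)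
  ultimately show "((\<lambda>z. inverse (F (g z))) has_field_derivative
      (\<Sum>m\<le>n. - (D m / (F v)\<^sup>2) * g' m)) (at 0)"
    by simp
qed

text \<open>Existence is recorded without a formula: the trace argument uses only that the two
  Jacobians are inverse to each other.\<close>

lemma gradient_exists_sum:
  assumes "\<And>i. i \<in> I \<Longrightarrow> \<exists>D. has_gradient n v (F i) D"
  shows "\<exists>D. has_gradient n v (\<lambda>w. \<Sum>i\<in>I. F i w) D"
  using assms
proof (induction I rule: infinite_finite_induct)
  case (insert i I)
  obtain D where D: "has_gradient n v (F i) D" using insert.prems by blast
  obtain E where E: "has_gradient n v (\<lambda>w. \<Sum>i\<in>I. F i w) E"
    using insert.IH insert.prems by blast
  show ?case
    using has_gradient_add[OF D E] insert.hyps by auto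
qed (simp_all, (rule exI, rule has_gradient_const)+)

lemma gradient_exists_prod:
  assumes "\<And>i. i \<in> I \<Longrightarrow> \<exists>D. has_gradient n v (F i) D"
  shows "\<exists>D. has_gradient n v (\<lambda>w. \<Prod>i\<in>I. F i w) D"
  using assms
proof (induction I rule: infinite_finite_induct)
  case (insert i I)
  obtain D where D: "has_gradient n v (F i) D" using insert.prems by blast
  obtain E where E: "has_gradient n v (\<lambda>w. \<Prod>i\<in>I. F i w) E"
    using insert.IH insert.prems by blast
  show ?case
    using has_gradient_mult[OF D E] insert.hyps by auto
qed (simp_all, (rule exI, rule has_gradient_const)+)

lemma gradient_exists_power:
  assumes "\<exists>D. has_gradient n v F D"
  shows "\<exists>D. has_gradient n v (\<lambda>w. F w ^ k) D"
proof (induction k)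
  case 0
  show ?case by (simp, rule exI, rule has_gradient_const)
next
  case (Suc k)
  obtain D where D: "has_gradient n v F D" using assms by blast
  obtain E where E: "has_gradient n v (\<lambda>w. F w ^ k) E" using Suc.IH by blast
  show ?case unfolding power_Suc by (rule exI, rule has_gradient_mult[OF D E])
qed

lemma gradient_exists_mpoly_eval:
  "\<exists>D. has_gradient n v (\<lambda>w. mpoly_eval (case_prod (x(i := w))) F) D"
proof -
  have coord: "\<exists>D. has_gradient n v (\<lambda>w. case_prod (x(i := w)) e) D" for e
  proof (cases "fst e = i")
    case True
    then show ?thesis
      using has_gradient_coordinate[of n v "snd e"] by (auto simp: case_prod_beta)
  next
    case False
    then show ?thesis
      using has_gradient_const[of n v "x (fst e) (snd e)"] by (auto simp: case_prod_beta)
  qed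
  have "\<exists>D. has_gradient n v (\<lambda>w. Poly_Mapping.lookup F m *
      (\<Prod>e\<in>Poly_Mapping.keys m. case_prod (x(i := w)) e ^ Poly_Mapping.lookup m e)) D" for m
  proof -
    have "\<exists>D. has_gradient n v
        (\<lambda>w. \<Prod>e\<in>Poly_Mapping.keys m. case_prod (x(i := w)) e ^ Poly_Mapping.lookup m e) D"
      by (rule gradient_exists_prod, rule gradient_exists_power, rule coord)
    then obtain D where "has_gradient n v
        (\<lambda>w. \<Prod>e\<in>Poly_Mapping.keys m. case_prod (x(i := w)) e ^ Poly_Mapping.lookup m e) D" ..
    from has_gradient_mult[OF has_gradient_const this] show ?thesis by blast
  qed
  then show ?thesis unfolding mpoly_eval_def by (rule gradient_exists_sum)
qed

text \<open>A function with gradient is continuous along curves. Distinguished open sets are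
  therefore neighbourhoods as seen by every curve, the only sense of openness needed for the
  Jacobians.\<close>

lemma has_gradient_eventually_nonzero:
  assumes "has_gradient n v F D" "curve_at n v g g'" "F v \<noteq> 0"
  shows "eventually (\<lambda>z. F (g z) \<noteq> 0) (nhds 0)"
proof -
  have "((\<lambda>z. F (g z)) has_field_derivative (\<Sum>m\<le>n. D m * g' m)) (at 0)"
    using assms(1,2) unfolding has_gradient_def by blast
  then have "isCont (\<lambda>z. F (g z)) 0" by (rule DERIV_isCont)
  then have "((\<lambda>z. F (g z)) \<longlongrightarrow> F (g 0)) (nhds 0)"
    unfolding isCont_def tendsto_at_iff_tendsto_nhds[of "\<lambda>z. F (g z)"] .
  moreover have "F (g 0) \<noteq> 0" using assms(2,3) by (simp add: curve_at_def)
  ultimately show ?thesis by (rule tendsto_imp_eventually_ne)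
qed

section \<open>Jacobians of morphisms between affine charts\<close>

lemma curve_at_line:
  assumes "h \<le> n"
  shows "curve_at n v (\<lambda>z m. v m + z * (if m = h then 1 else 0)) (\<lambda>m. if m = h then 1 else 0)"
  using assms unfolding curve_at_def
  by (auto intro!: derivative_eq_intros)

text \<open>With the factors other than \<open>i\<close> frozen, the fractions of
  \<open>morphism_local_rep_chart\<close> become a map \<open>R\<close> of vectors, and
  \<open>U\<close> is the set where their denominators are under control.\<close>

lemma morphism_chart:
  assumes mor: "variety_morphism (multiprojective_space ns) (multiprojective_space ms) \<phi>"
    and x: "valid_coords ns x" and i: "i < length ns" and j: "j < length ms"
    and l: "l \<le> ms ! j" and u: "u \<in> \<phi> (point_of ns x) j" "u l \<noteq> 0"
  shows "\<exists>R A U. (\<forall>k. has_gradient (ns ! i) (x i) (\<lambda>v. R v k) (A k)) \<and>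
    (\<forall>g g'. curve_at (ns ! i) (x i) g g' \<longrightarrow> eventually (\<lambda>z. g z \<in> U) (nhds 0)) \<and>
    x i \<in> U \<and>
    (\<forall>v\<in>U. v \<in> punctured_space (ns ! i) \<longrightarrow> R v l = 1 \<and> R v \<in> \<phi> (point_of ns (x(i := v))) j)"
proof -
  let ?e = "\<lambda>v P. mpoly_eval (case_prod (x(i := v))) P"
  obtain F G H where
    H0: "\<forall>k\<le>ms ! j. mpoly_eval (case_prod x) (H k) \<noteq> 0" and
    rep: "\<forall>x. valid_coords ns x \<and> (\<forall>k\<le>ms ! j. mpoly_eval (case_prod x) (H k) \<noteq> 0) \<longrightarrow>
      (\<forall>k\<le>ms ! j. mpoly_eval (case_prod x) (G k) \<noteq> 0) \<and>
      mpoly_eval (case_prod x) (F l) / mpoly_eval (case_prod x) (G l) = 1 \<and>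
      (\<lambda>k. if k \<le> ms ! j then mpoly_eval (case_prod x) (F k) / mpoly_eval (case_prod x) (G k) else 0)
        \<in> \<phi> (point_of ns x) j"
    using morphism_local_rep_chart[OF mor x j l u] by blast
  define R where "R v k = (if k \<le> ms ! j then ?e v (F k) / ?e v (G k) else 0)" for v k
  define U where "U = {v. \<forall>k\<le>ms ! j. ?e v (H k) \<noteq> 0}"
  have xx: "x(i := x i) = x" by simp
  have G0: "?e (x i) (G k) \<noteq> 0" if "k \<le> ms ! j" for k
    using rep x H0 that unfolding xx by blast
  have "\<exists>D. has_gradient (ns ! i) (x i) (\<lambda>v. R v k) D" for k
  proof (cases "k \<le> ms ! j")
    case True
    obtain D where D: "has_gradient (ns ! i) (x i) (\<lambda>v. ?e v (F k)) D"
      using gradient_exists_mpoly_eval[of "ns ! i" "x i" x i "F k"] by blast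
    obtain E where E: "has_gradient (ns ! i) (x i) (\<lambda>v. ?e v (G k)) E"
      using gradient_exists_mpoly_eval[of "ns ! i" "x i" x i "G k"] by blast
    have "(\<lambda>v. R v k) = (\<lambda>v. ?e v (F k) * inverse (?e v (G k)))"
      using True unfolding R_def divide_inverse by simp
    then show ?thesis
      using has_gradient_mult[OF D has_gradient_inverse[OF E G0[OF True]]] by (simp only: exI)
  next
    case False
    then show ?thesis using has_gradient_const[of _ _ 0] by (auto simp: R_def)
  qed
  then obtain A where A: "\<forall>k. has_gradient (ns ! i) (x i) (\<lambda>v. R v k) (A k)" by metis
  have ev: "eventually (\<lambda>z. g z \<in> U) (nhds 0)" if g: "curve_at (ns ! i) (x i) g g'" for g g'
  proof -
    have "eventually (\<lambda>z. ?e (g z) (H k) \<noteq> 0) (nhds 0)" if "k \<in> {..ms ! j}" for k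
    proof -
      obtain D where D: "has_gradient (ns ! i) (x i) (\<lambda>v. ?e v (H k)) D"
        using gradient_exists_mpoly_eval[of "ns ! i" "x i" x i "H k"] by blast
      have "?e (x i) (H k) \<noteq> 0" using H0 that unfolding xx by blast
      then show ?thesis by (rule has_gradient_eventually_nonzero[OF D g])
    qed
    then have "eventually (\<lambda>z. \<forall>k\<in>{..ms ! j}. ?e (g z) (H k) \<noteq> 0) (nhds 0)"
      by (simp add: eventually_ball_finite_distrib)
    then show ?thesis by (simp add: U_def Ball_def)
  qed
  have "x i \<in> U" using H0 by (simp add: U_def)
  moreover have "R v l = 1 \<and> R v \<in> \<phi> (point_of ns (x(i := v))) j"
    if v: "v \<in> U" "v \<in> punctured_space (ns ! i)" for v
  proof -
    have "valid_coords ns (x(i := v))" by (rule valid_coords_update[OF x v(2)])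
    then show ?thesis
      using rep[rule_format, of "x(i := v)"] v(1) l unfolding U_def R_def by auto
  qed
  ultimately show ?thesis using A ev by blast
qed

text \<open>The chain rule for \<open>R' \<circ> R = id\<close> on the affine chart \<open>v\<^sub>p = 1\<close>; the coordinate \<open>l\<close> drops
  out because \<open>R v l = 1\<close>.\<close>

lemma chart_jacobian_inverse:
  assumes R: "\<And>k. has_gradient a v (\<lambda>v. R v k) (A k)"
    and R': "\<And>k. has_gradient b w (\<lambda>v. R' v k) (B k)"
    and U: "\<And>g g'. curve_at a v g g' \<Longrightarrow> eventually (\<lambda>z. g z \<in> U) (nhds 0)"
    and U': "\<And>g g'. curve_at b w g g' \<Longrightarrow> eventually (\<lambda>z. g z \<in> U') (nhds 0)"
    and w: "R v = w" and v: "v p = 1" "v \<in> punctured_space a"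
    and norm: "\<And>u. u \<in> U \<Longrightarrow> u \<in> punctured_space a \<Longrightarrow> R u l = 1 \<and> (\<forall>k>b. R u k = 0)"
    and inv: "\<And>u. u \<in> U \<Longrightarrow> u \<in> punctured_space a \<Longrightarrow> u p = 1 \<Longrightarrow> R u \<in> U' \<Longrightarrow> R' (R u) = u"
    and h: "h \<le> a" "h \<noteq> p" and l: "l \<le> b"
  shows "(\<Sum>k\<in>{..b} - {l}. B m k * A k h) = (if m = h then 1 else 0)"
proof -
  \<comment> \<open>The coordinate line in direction \<open>h\<close>; since \<open>h\<close> is not
    \<open>p\<close>, it keeps coordinate \<open>p\<close> equal to 1 and stays in the affine
    chart.\<close>
  define g where "g z m = v m + z * (if m = h then 1 else 0)" for z m
  have g: "curve_at a v g (\<lambda>m. if m = h then 1 else 0)"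
    unfolding g_def using curve_at_line[OF h(1)] .
  have gp: "g z \<in> punctured_space a" "g z p = 1" for z
    using v h unfolding g_def punctured_space_def by (auto intro!: exI[of _ p])
  have gU: "eventually (\<lambda>z. g z \<in> U) (nhds 0)" by (rule U[OF g])
  have dR: "((\<lambda>z. R (g z) k) has_field_derivative A k h) (at 0)" for k
  proof -
    have "((\<lambda>z. R (g z) k) has_field_derivative (\<Sum>m\<le>a. A k m * (if m = h then 1 else 0))) (at 0)"
      using R[of k] g unfolding has_gradient_def by blast
    moreover have "(\<Sum>m\<le>a. A k m * (if m = h then 1 else 0)) = A k h"
    proof -
      have "(\<Sum>m\<le>a. A k m * (if m = h then 1 else 0)) = (\<Sum>m\<le>a. if m = h then A k m else 0)"
        by (rule sum.cong) auto
      then show ?thesis using h(1) by simp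
    qed
    ultimately show ?thesis by simp
  qed
  \<comment> \<open>Coordinates of \<open>R\<close> that are constant along the line near 0
    contribute a zero entry; this concerns \<open>l\<close> and all indices beyond
    \<open>b\<close>.\<close>
  have const: "A k h = 0" if "eventually (\<lambda>z. R (g z) k = c) (nhds 0)" for k c
  proof -
    have "((\<lambda>z. R (g z) k) has_field_derivative 0) (at 0)"
      using DERIV_cong_ev[OF refl that refl] by simp
    then show ?thesis using DERIV_unique[OF dR] by blast
  qed
  have Al: "A l h = 0"
    by (rule const[of l 1]) (use gU in eventually_elim, use norm gp in blast)
  have Ab: "A k h = 0" if "k > b" for k
    by (rule const[of k 0]) (use gU in eventually_elim, use norm gp that in blast)
  have "g 0 = v" by (rule ext) (simp add: g_def)
  \<comment> \<open>The image of the line is again a curve, now at \<open>w\<close>, so the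
    gradients of \<open>R'\<close> can be evaluated along it.\<close>
  then have Rg: "curve_at b w (\<lambda>z. R (g z)) (\<lambda>k. A k h)"
    unfolding curve_at_def using dR Ab w by simp
  have deriv: "((\<lambda>z. R' (R (g z)) m) has_field_derivative (\<Sum>k\<le>b. B m k * A k h)) (at 0)"
    using R'[of m] Rg unfolding has_gradient_def by blast
  have ev: "eventually (\<lambda>z. R' (R (g z)) m = g z m) (nhds 0)"
    using gU U'[OF Rg] by eventually_elim (use inv gp in auto)
  have "((\<lambda>z. g z m) has_field_derivative (\<Sum>k\<le>b. B m k * A k h)) (at 0)"
    using deriv unfolding DERIV_cong_ev[OF refl ev refl] .
  moreover have "((\<lambda>z. g z m) has_field_derivative (if m = h then 1 else 0)) (at 0)"
    using g by (simp add: curve_at_def)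
  ultimately have "(\<Sum>k\<le>b. B m k * A k h) = (if m = h then 1 else 0)"
    by (rule DERIV_unique)
  moreover have "(\<Sum>k\<le>b. B m k * A k h) = (\<Sum>k\<in>{..b} - {l}. B m k * A k h)"
    using l Al by (subst sum.remove[of _ l]) auto
  ultimately show ?thesis by simp
qed

text \<open>Two inverse Jacobians \<open>A\<close> and \<open>B\<close> of sizes \<open>b \<times> a\<close> and \<open>a \<times> b\<close> satisfy
  \<open>a = tr (B A) = tr (A B) = b\<close>.\<close>

lemma matching_factors_same_dimension:
  assumes mor: "variety_morphism (multiprojective_space ns) (multiprojective_space ms) \<phi>"
    and mor': "variety_morphism (multiprojective_space ms) (multiprojective_space ns) \<psi>"
    and inv: "\<And>x. x \<in> multiproj_points ns \<Longrightarrow> \<psi> (\<phi> x) = x"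
    and inv': "\<And>y. y \<in> multiproj_points ms \<Longrightarrow> \<phi> (\<psi> y) = y"
    and i: "i < length ns" and j: "j < length ms"
    and indep: "\<And>k. k < length ms \<Longrightarrow> k \<noteq> j \<Longrightarrow> \<not> depends_on ns \<phi> i k"
    and indep': "\<And>k. k < length ns \<Longrightarrow> k \<noteq> i \<Longrightarrow> \<not> depends_on ms \<psi> j k"
  shows "ns ! i = ms ! j"
proof -
  obtain P where P: "P \<in> multiproj_points ns" using multiproj_points_nonempty by blast
  define Q where "Q = \<phi> P"
  have Q: "Q \<in> multiproj_points ms" unfolding Q_def by (rule morphism_maps_points[OF mor P])
  have PQ: "\<psi> Q = P" unfolding Q_def by (rule inv[OF P])
  obtain x0 where x0: "valid_coords ns x0" "P = point_of ns x0" using point_obtain_coords[OF P] .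
  have x0i: "x0 i \<in> punctured_space (ns ! i)" using x0(1) i by (simp add: valid_coords_def)
  then obtain p where p: "p \<le> ns ! i" "x0 i p \<noteq> 0"
    unfolding punctured_space_def by (force simp: not_le[symmetric])
  \<comment> \<open>The representative of the base point that lies in the affine chart
    \<open>p\<close>.\<close>
  define v where "v = (\<lambda>m. (1 / x0 i p) * x0 i m)"
  have v: "v \<in> punctured_space (ns ! i)" "v p = 1" "proj_class (ns ! i) v = proj_class (ns ! i) (x0 i)"
    using x0i p proj_class_scale[of "1 / x0 i p" "ns ! i" "x0 i"]
    by (auto simp: v_def punctured_space_def)
  define x where "x = x0(i := v)"
  have x: "valid_coords ns x" "P = point_of ns x" "x i = v"
  proof -
    show "valid_coords ns x" unfolding x_def by (rule valid_coords_update[OF x0(1) v(1)])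
    show "P = point_of ns x" unfolding x_def x0(2) by (rule point_of_cong) (simp add: v(3))
  qed (simp add: x_def)
  obtain y0 where y0: "valid_coords ms y0" "Q = point_of ms y0" using point_obtain_coords[OF Q] .
  have y0j: "y0 j \<in> punctured_space (ms ! j)" using y0(1) j by (simp add: valid_coords_def)
  then obtain l where l: "l \<le> ms ! j" "y0 j l \<noteq> 0"
    unfolding punctured_space_def by (force simp: not_le[symmetric])
  have "y0 j \<in> \<phi> (point_of ns x) j"
    using y0(2) j self_mem_proj_class[OF y0j] unfolding x(2)[symmetric] Q_def[symmetric]
    by (simp add: point_of_apply)
  from morphism_chart[OF mor x(1) i j l(1) this l(2)] obtain R A U where
    R: "\<And>k. has_gradient (ns ! i) v (\<lambda>v. R v k) (A k)" and
    U: "\<And>g g'. curve_at (ns ! i) v g g' \<Longrightarrow> eventually (\<lambda>z. g z \<in> U) (nhds 0)" "v \<in> U" and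
    RU: "\<And>u. u \<in> U \<Longrightarrow> u \<in> punctured_space (ns ! i) \<Longrightarrow> R u l = 1 \<and> R u \<in> \<phi> (point_of ns (x(i := u))) j"
    unfolding x(3) by blast
  define w where "w = R v"
  have wl: "w l = 1" and wQ: "w \<in> Q j"
    using RU[OF U(2) v(1)] x unfolding w_def Q_def by (auto simp: fun_upd_idem)
  have w: "w \<in> punctured_space (ms ! j)" "proj_class (ms ! j) w = proj_class (ms ! j) (y0 j)"
    using proj_class_mem_punctured proj_class_eq_of_mem wQ unfolding y0(2) point_of_apply[OF j]
    by blast+
  define y where "y = y0(j := w)"
  have y: "valid_coords ms y" "Q = point_of ms y" "y j = w"
  proof -
    show "valid_coords ms y" unfolding y_def by (rule valid_coords_update[OF y0(1) w(1)])
    show "Q = point_of ms y" unfolding y_def y0(2) by (rule point_of_cong) (simp add: w(2))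
  qed (simp add: y_def)
  have "v \<in> \<psi> (point_of ms y) i"
    unfolding y(2)[symmetric] PQ unfolding x(2) using x(3) i self_mem_proj_class[OF v(1)]
    by (simp add: point_of_apply)
  moreover have "v p \<noteq> 0" using v(2) by simp
  ultimately obtain R' B U' where
    R': "\<And>k. has_gradient (ms ! j) w (\<lambda>v. R' v k) (B k)" and
    U': "\<And>g g'. curve_at (ms ! j) w g g' \<Longrightarrow> eventually (\<lambda>z. g z \<in> U') (nhds 0)" "w \<in> U'" and
    RU': "\<And>u. u \<in> U' \<Longrightarrow> u \<in> punctured_space (ms ! j) \<Longrightarrow> R' u p = 1 \<and> R' u \<in> \<psi> (point_of ms (y(j := u))) i"
    using morphism_chart[OF mor' y(1) j i p(1), of v] unfolding y(3) by blast
  \<comment> \<open>No component other than the \<open>j\<close>-th depends on factor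
    \<open>i\<close>, so \<open>\<phi>\<close> carries the slice through \<open>P\<close> in
    direction \<open>i\<close> into the slice through \<open>Q\<close> in direction
    \<open>j\<close>.\<close>
  have slice: "\<phi> (P(i := q)) = Q(j := \<phi> (P(i := q)) j)" if q: "q \<in> projective_space (ns ! i)" for q
  proof (rule extensionalityI[of _ "{..<length ms}"])
    have "\<phi> (P(i := q)) \<in> multiproj_points ms"
      by (rule morphism_maps_points[OF mor point_update_in_points[OF P i q]])
    then show "\<phi> (P(i := q)) \<in> extensional {..<length ms}" by (simp add: multiproj_points_def PiE_iff)
    show "Q(j := \<phi> (P(i := q)) j) \<in> extensional {..<length ms}"
      using Q j by (auto simp: multiproj_points_def PiE_iff extensional_def)
    show "\<phi> (P(i := q)) k = (Q(j := \<phi> (P(i := q)) j)) k" if "k \<in> {..<length ms}" for k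
      using independent_update[OF indep P q] that by (cases "k = j") (simp_all add: Q_def)
  qed
  have slice': "\<psi> (Q(j := q)) = P(i := \<psi> (Q(j := q)) i)" if q: "q \<in> projective_space (ms ! j)" for q
  proof (rule extensionalityI[of _ "{..<length ns}"])
    have "\<psi> (Q(j := q)) \<in> multiproj_points ns"
      by (rule morphism_maps_points[OF mor' point_update_in_points[OF Q j q]])
    then show "\<psi> (Q(j := q)) \<in> extensional {..<length ns}" by (simp add: multiproj_points_def PiE_iff)
    show "P(i := \<psi> (Q(j := q)) i) \<in> extensional {..<length ns}"
      using P i by (auto simp: multiproj_points_def PiE_iff extensional_def)
    show "\<psi> (Q(j := q)) k = (P(i := \<psi> (Q(j := q)) i)) k" if "k \<in> {..<length ns}" for k
      using independent_update[OF indep' Q q] that by (cases "k = i") (simp_all add: PQ)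
  qed
  have Ru: "R u l = 1" "R u \<in> punctured_space (ms ! j)"
      "\<phi> (P(i := proj_class (ns ! i) u)) = Q(j := proj_class (ms ! j) (R u))"
    if u: "u \<in> U" "u \<in> punctured_space (ns ! i)" for u
  proof -
    show "R u l = 1" using RU[OF u] by blast
    have q: "proj_class (ns ! i) u \<in> projective_space (ns ! i)" using proj_class_in_projective_space u(2) by blast
    have "R u \<in> \<phi> (P(i := proj_class (ns ! i) u)) j"
      using RU[OF u] by (simp add: x(2) point_of_update[OF i])
    moreover have "\<phi> (P(i := proj_class (ns ! i) u)) j \<in> projective_space (ms ! j)"
      using morphism_maps_points[OF mor point_update_in_points[OF P i q]] j
      by (auto simp: multiproj_points_def PiE_iff)
    ultimately show "R u \<in> punctured_space (ms ! j)"
      "\<phi> (P(i := proj_class (ns ! i) u)) = Q(j := proj_class (ms ! j) (R u))"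
      using projective_space_eq_proj_class slice[OF q] by metis+
  qed
  have Ru': "R' u p = 1" "R' u \<in> punctured_space (ns ! i)"
      "\<psi> (Q(j := proj_class (ms ! j) u)) = P(i := proj_class (ns ! i) (R' u))"
    if u: "u \<in> U'" "u \<in> punctured_space (ms ! j)" for u
  proof -
    show "R' u p = 1" using RU'[OF u] by blast
    have q: "proj_class (ms ! j) u \<in> projective_space (ms ! j)" using proj_class_in_projective_space u(2) by blast
    have "R' u \<in> \<psi> (Q(j := proj_class (ms ! j) u)) i"
      using RU'[OF u] by (simp add: y(2) point_of_update[OF j])
    moreover have "\<psi> (Q(j := proj_class (ms ! j) u)) i \<in> projective_space (ns ! i)"
      using morphism_maps_points[OF mor' point_update_in_points[OF Q j q]] i
      by (auto simp: multiproj_points_def PiE_iff)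
    ultimately show "R' u \<in> punctured_space (ns ! i)"
      "\<psi> (Q(j := proj_class (ms ! j) u)) = P(i := proj_class (ns ! i) (R' u))"
      using projective_space_eq_proj_class slice'[OF q] by metis+
  qed
  \<comment> \<open>A point has at most one representative with a prescribed coordinate equal to 1.
    This turns equalities of points into equalities of vectors.\<close>
  have normalized: "u = u'"
    if u: "u \<in> punctured_space n" "proj_class n u = proj_class n u'" "u c = 1" "u' c = 1"
      "u' \<in> punctured_space n" for u u' :: "nat \<Rightarrow> complex" and n c
  proof -
    obtain e where "u = (\<lambda>m. e * u' m)"
      using self_mem_proj_class[OF u(1)] u(2) mem_proj_class[OF u(5)] by auto
    then show ?thesis using u(3,4) by auto
  qed
  have RR: "R' (R u) = u" if u: "u \<in> U" "u \<in> punctured_space (ns ! i)" "u p = 1" "R u \<in> U'" for u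
  proof -
    note r = Ru[OF u(1,2)] and r' = Ru'[OF u(4) Ru(2)[OF u(1,2)]]
    have "P(i := proj_class (ns ! i) u) = P(i := proj_class (ns ! i) (R' (R u)))"
      using inv[OF point_update_in_points[OF P i proj_class_in_projective_space[OF u(2)]]] r(3) r'(3)
      by simp
    then have "proj_class (ns ! i) (R' (R u)) = proj_class (ns ! i) u" by (metis fun_upd_same)
    then show ?thesis using normalized r'(1,2) u(2,3) by blast
  qed
  have RR': "R (R' u) = u" if u: "u \<in> U'" "u \<in> punctured_space (ms ! j)" "u l = 1" "R' u \<in> U" for u
  proof -
    note r = Ru'[OF u(1,2)] and r' = Ru[OF u(4) Ru'(2)[OF u(1,2)]]
    have "Q(j := proj_class (ms ! j) u) = Q(j := proj_class (ms ! j) (R (R' u)))"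
      using inv'[OF point_update_in_points[OF Q j proj_class_in_projective_space[OF u(2)]]] r(3) r'(3)
      by simp
    then have "proj_class (ms ! j) (R (R' u)) = proj_class (ms ! j) u" by (metis fun_upd_same)
    then show ?thesis using normalized r'(1,2) u(2,3) by blast
  qed
  have w': "R' w = v" unfolding w_def using RR[OF U(2) v(1,2)] U'(2) w_def by blast
  have BA: "(\<Sum>k\<in>{..ms ! j} - {l}. B m k * A k h) = (if m = h then 1 else 0)"
    if "h \<in> {..ns ! i} - {p}" for m h
  proof (rule chart_jacobian_inverse[OF R R' U(1) U'(1) w_def[symmetric] v(2,1)])
    show "R u l = 1 \<and> (\<forall>k>ms ! j. R u k = 0)" if "u \<in> U" "u \<in> punctured_space (ns ! i)" for u
      using Ru(1,2)[OF that] by (auto simp: punctured_space_def)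
  qed (use RR that l in auto)
  have AB: "(\<Sum>k\<in>{..ns ! i} - {p}. A m k * B k h) = (if m = h then 1 else 0)"
    if "h \<in> {..ms ! j} - {l}" for m h
  proof (rule chart_jacobian_inverse[OF R' R U'(1) U(1) w' wl w(1)])
    show "R' u p = 1 \<and> (\<forall>k>ns ! i. R' u k = 0)" if "u \<in> U'" "u \<in> punctured_space (ms ! j)" for u
      using Ru'(1,2)[OF that] by (auto simp: punctured_space_def)
  qed (use RR' that p in auto)
  \<comment> \<open>Removing \<open>p\<close> from the \<open>ns ! i + 1\<close> homogeneous indices
    leaves \<open>ns ! i\<close> diagonal entries, each equal to 1. The comparison takes place in
    the complex numbers, where \<open>of_nat\<close> is injective.\<close>
  have "of_nat (ns ! i) = (\<Sum>m\<in>{..ns ! i} - {p}. \<Sum>k\<in>{..ms ! j} - {l}. B m k * A k m)"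
    using p(1) by (simp add: BA)
  also have "\<dots> = (\<Sum>k\<in>{..ms ! j} - {l}. \<Sum>m\<in>{..ns ! i} - {p}. A k m * B m k)"
    by (subst sum.swap) (simp add: mult.commute)
  also have "\<dots> = of_nat (ms ! j)"
    using l(1) by (simp add: AB)
  finally have "(of_nat (ns ! i) :: complex) = of_nat (ms ! j)" .
  then show ?thesis by (simp only: of_nat_eq_iff)
qed

text \<open>The dependence relations of \<open>\<phi>\<close> and \<open>\<psi>\<close> single out a
  bijection \<open>\<tau>\<close> of the index sets along which the dimensions agree; this is an
  equality of multisets.\<close>

lemma isomorphic_multiprojective_spaces_mset:
  assumes ns: "0 \<notin> set ns" and ms: "0 \<notin> set ms"
    and iso: "isomorphic_varieties (multiprojective_space ns) (multiprojective_space ms)"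
  shows "mset ns = mset ms"
proof -
  obtain \<phi> \<psi> where mor: "variety_morphism (multiprojective_space ns) (multiprojective_space ms) \<phi>"
    and mor': "variety_morphism (multiprojective_space ms) (multiprojective_space ns) \<psi>"
    and inv: "\<And>x. x \<in> multiproj_points ns \<Longrightarrow> \<psi> (\<phi> x) = x"
    and inv': "\<And>y. y \<in> multiproj_points ms \<Longrightarrow> \<phi> (\<psi> y) = y"
    using iso unfolding isomorphic_varieties_def by auto
  \<comment> \<open>In both relations the first index is a factor of the source and the second one
    of the target: \<open>?D i j\<close> says that the \<open>j\<close>-th component of
    \<open>\<phi>\<close> depends on factor \<open>i\<close>, \<open>?E i j\<close> that the
    \<open>i\<close>-th component of \<open>\<psi>\<close> depends on factor
    \<open>j\<close>.\<close>
  let ?D = "\<lambda>i j. depends_on ns \<phi> i j" and ?E = "\<lambda>i j. depends_on ms \<psi> j i"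
  let ?I = "{..<length ns}" and ?J = "{..<length ms}"
  have exE: "\<exists>j\<in>?J. ?E i j" if "i \<in> ?I" for i
    using depends_on_some_factor[OF mor inv] that ns by (metis gr0I lessThan_iff nth_mem)
  have exD: "\<exists>i\<in>?I. ?D i j" if "j \<in> ?J" for j
    using depends_on_some_factor[OF mor' inv'] that ms by (metis gr0I lessThan_iff nth_mem)
  have DE: "k = j" if "i \<in> ?I" "j \<in> ?J" "k \<in> ?J" "?D i j" "?E i k" for i j k
    using depends_on_imp_inverse_independent[OF mor mor' inv'] that by blast
  have ED: "k = i" if "i \<in> ?I" "j \<in> ?J" "k \<in> ?I" "?E i j" "?D k j" for i j k
    using depends_on_imp_inverse_independent[OF mor' mor inv] that by blast
  obtain \<tau> where \<tau>: "\<And>i. i \<in> ?I \<Longrightarrow> \<tau> i \<in> ?J \<and> ?E i (\<tau> i)"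
    using exE by metis
  \<comment> \<open>Some factor \<open>k\<close> satisfies \<open>?D k (\<tau> i)\<close>, and
    \<open>ED\<close> identifies it with \<open>i\<close>.\<close>
  have D\<tau>: "?D i (\<tau> i)" if "i \<in> ?I" for i
    using exD[of "\<tau> i"] \<tau>[OF that] ED[OF that] by blast
  have inj: "inj_on \<tau> ?I"
    using D\<tau> \<tau> ED by (intro inj_onI) metis
  have surj: "\<tau> ` ?I = ?J"
  proof
    show "?J \<subseteq> \<tau> ` ?I"
    proof
      fix j assume j: "j \<in> ?J"
      then obtain i where i: "i \<in> ?I" "?D i j" using exD by blast
      then have "\<tau> i = j" using DE[OF i(1) j] \<tau>[OF i(1)] by blast
      then show "j \<in> \<tau> ` ?I" using i(1) by blast
    qed
  qed (use \<tau> in blast)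
  have dim: "ns ! i = ms ! \<tau> i" if i: "i \<in> ?I" for i
  proof (rule matching_factors_same_dimension[OF mor mor' inv inv'])
    show "\<not> ?D i k" if "k < length ms" "k \<noteq> \<tau> i" for k
      using DE[OF i _ _ _ conjunct2[OF \<tau>[OF i]]] \<tau>[OF i] that by auto
    show "\<not> depends_on ms \<psi> (\<tau> i) k" if "k < length ns" "k \<noteq> i" for k
      using ED[OF _ _ i _ D\<tau>[OF i]] \<tau>[OF i] that by auto
  qed (use i \<tau> in auto)
  \<comment> \<open>A list seen as a function on its index set, so that reindexing by
    \<open>\<tau>\<close> leaves the multiset of values unchanged.\<close>
  have mset_nth: "mset xs = image_mset ((!) xs) (mset_set {..<length xs})" for xs :: "nat list"
    by (metis map_nth mset_map mset_set_upto_eq_mset_upto)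
  have "mset ms = image_mset ((!) ms) (image_mset \<tau> (mset_set ?I))"
    unfolding image_mset_mset_set[OF inj] surj by (rule mset_nth)
  also have "\<dots> = image_mset ((!) ns) (mset_set ?I)"
    using dim by (auto simp: multiset.map_comp intro!: image_mset_cong)
  also have "\<dots> = mset ns" by (rule mset_nth[symmetric])
  finally show ?thesis ..
qed

theorem theorem1:
  fixes n :: nat and ns ms :: "nat list"
  assumes "n > 0"
    and "partition_of ns n"
    and "partition_of ms n"
    and "mset ns \<noteq> mset ms"
  shows "\<not> isomorphic_varieties (multiprojective_space ns) (multiprojective_space ms)"
  using isomorphic_multiprojective_spaces_mset[of ns ms] assms by (auto simp: partition_of_def)

end
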